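(* Let $1\le p\le q<\infty$ and let $z\in\mathbb{C}$ with $|z|\le 1$ be such that the two-point inequality $$\left(\frac{|a+zb|^{q}+|a-zb|^{q}}{2}\right)^{1/q}\le\left(\frac{|a+b|^{p}+|a-b|^{p}}{2}\right)^{1/p}$$ holds for all $a,b\in\mathbb{C}$. Let $L\ge 0$ be an integer, let $a_0,\dots,a_L\in\mathbb{C}$, and let $g(w)=\sum_{\ell=0}^{L}a_\ell w^\ell$. Then the map $$s\mapsto\int_{\mathbb{R}}\left(\int_{\mathbb{R}}\left|\int_{\mathbb{R}}\int_{\mathbb{R}}g\big((u+iv)\sqrt{s}+z(x+iy)\sqrt{1-s}\big)\,d\gamma(v)\,d\gamma(y)\right|^{q}d\gamma(x)\right)^{p/q}d\gamma(u)$$ is monotonically increasing on $0\le s\le 1$.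
   Context: Here $d\gamma(x)=\frac{e^{-x^{2}/2}}{\sqrt{2\pi}}\,dx$ is the standard Gaussian measure on $\mathbb{R}$, and $i$ is the imaginary unit. "Monotonically increasing" is meant in the non-strict sense (non-decreasing). *)

theory Defs
  imports "HOL-Probability.Probability"
begin

end

theory Submission
  imports Defs "HOL-Computational_Algebra.Polynomial" "HOL-Real_Asymp.Real_Asymp"
begin

text \<open>
  Increasing \<open>s\<close> transfers variance from the inner Gaussian variable, which carries the factor \<open>z\<close> and
  is measured in \<open>L\<^sup>q\<close>, to the outer one, which is measured in \<open>L\<^sup>p\<close>. For \<open>s < t\<close>, rotation invariance of
  the Gaussian isolates an independent Gaussian variable with variance \<open>t - s\<close> that belongs to the
  inner integral at time \<open>s\<close> and to the outer integral at time \<open>t\<close>; everything else is common to both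
  times. Two facts show that moving this variable increases the value: complex
  hypercontractivity in the single moving variable removes its factor \<open>z\<close> at the price of replacing its
  \<open>L\<^sup>q\<close>-norm by an \<open>L\<^sup>p\<close>-norm, and Minkowski's integral inequality for the exponent \<open>q / p \<ge> 1\<close> pulls that
  \<open>L\<^sup>p\<close>-norm out of the remaining \<open>L\<^sup>q\<close>-norm (lemmas \<open>mixed_norm_step\<close> and \<open>mixed_norm_mono\<close>). The averages over the
  imaginary parts are convolutions with Gaussians of complex variance; on polynomials they commute
  and obey a semigroup law, so they do not interfere.

  What remains is hypercontractivity in one Gaussian variable: with \<open>H\<^sub>l\<close> the Hermite polynomials, the
  map \<open>H\<^sub>l \<mapsto> z\<^sup>l H\<^sub>l\<close> is a contraction from \<open>L\<^sup>p\<close> to \<open>L\<^sup>q\<close> on polynomials (lemma \<open>gaussian_hypercontractivity\<close>). Following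
  Beckner, the two-point inequality is tensorized on the discrete cube (lemma
  \<open>discrete_hypercontractivity\<close>) and the central limit theorem is applied. Only symmetric functions on the
  cube are needed, that is, combinations of the elementary symmetric polynomials in signs. As functions of the
  normalized sum of the signs these obey a three-term recurrence which tends to that of the Hermite
  polynomials as the dimension grows. Since the functions involved are unbounded, weak
  convergence is complemented by the convergence of the integrals of \<open>cosh\<close>, which dominates all powers of
  polynomials (lemma \<open>fair_binomial_limit\<close>).
\<close>

section \<open>Minkowski's integral inequality\<close>

text \<open>
  Multiplied out, this says that \<open>t powr r\<close> lies above its tangent at \<open>m\<close>. Young's inequality with
  the exponents \<open>1 / r\<close> and \<open>1 - 1 / r\<close> gives it without any differentiation.
\<close>
lemma powr_above_tangent:
  fixes r t m :: real
  assumes "1 \<le> r" "0 \<le> t" "0 < m"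
  shows "r * t * m powr (r - 1) \<le> t powr r + (r - 1) * m powr r"
proof (cases "t = 0")
  case False
  then have t: "t > 0" using assms by simp
  have "(t powr r) powr (1 / r) * (m powr r) powr (1 - 1 / r)
      \<le> (1 / r) * t powr r + (1 - 1 / r) * m powr r"
    using assms t by (intro Youngs_inequality_0) auto
  moreover have "(t powr r) powr (1 / r) = t" "(m powr r) powr (1 - 1 / r) = m powr (r - 1)"
    using assms t by (auto simp: powr_powr right_diff_distrib)
  ultimately have "r * (t * m powr (r - 1)) \<le> r * ((1 / r) * t powr r + (1 - 1 / r) * m powr r)"
    using assms by (intro mult_left_mono) auto
  also have "\<dots> = t powr r + (r - 1) * m powr r" using assms by (simp add: field_simps)
  finally show ?thesis by (simp add: mult.assoc)
qed (use assms in auto)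

text \<open>
  Let \<open>n x\<close> be the \<open>L\<^sup>r\<close>-norm of \<open>f x\<close> and \<open>S = \<integral>n\<close>. Writing \<open>\<integral>f x y dx\<close> as \<open>S\<close> times the average of
  \<open>f x y / n x\<close> with respect to the probability weight \<open>n / S\<close>, Jensen's inequality gives
  \<open>(\<integral>f x y dx)\<^sup>r \<le> S\<^sup>r\<^sup>-\<^sup>1 \<integral>(f x y)\<^sup>r (n x)\<^sup>1\<^sup>-\<^sup>r dx\<close>, and integrating over \<open>y\<close> turns the right-hand side into \<open>S\<^sup>r\<close>.
  To divide by \<open>n\<close> safely, an arbitrary \<open>e > 0\<close> is added to it; this costs only \<open>e\<close> in the conclusion.
\<close>
lemma minkowski_integral:
  fixes f :: "'a \<Rightarrow> 'b \<Rightarrow> real"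
  assumes M: "prob_space M" and N: "prob_space N" and r: "1 \<le> r"
    and f[measurable]: "case_prod f \<in> borel_measurable (M \<Otimes>\<^sub>M N)"
    and f0: "\<And>x y. 0 \<le> f x y"
    and fi: "\<And>x. x \<in> space M \<Longrightarrow> integrable N (\<lambda>y. f x y powr r)"
    and Ni: "integrable M (\<lambda>x. (\<integral>y. f x y powr r \<partial>N) powr (1 / r))"
  shows "(\<integral>y. (\<integral>x. f x y \<partial>M) powr r \<partial>N) powr (1 / r)
    \<le> (\<integral>x. (\<integral>y. f x y powr r \<partial>N) powr (1 / r) \<partial>M)"
proof (rule field_le_epsilon)
  fix e :: real assume e: "e > 0"
  interpret M: prob_space M by fact
  interpret N: prob_space N by fact
  interpret pair_sigma_finite M N ..
  define n where "n x = (\<integral>y. f x y powr r \<partial>N) powr (1 / r) + e" for x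
  have nm[measurable]: "n \<in> borel_measurable M" unfolding n_def by measurable
  have ne: "n x \<ge> e" for x unfolding n_def by simp
  have n0: "n x > 0" for x using ne[of x] e by simp
  have ni: "integrable M n" unfolding n_def using Ni by auto
  define S where "S = (\<integral>x. n x \<partial>M)"
  have S: "S = (\<integral>x. (\<integral>y. f x y powr r \<partial>N) powr (1 / r) \<partial>M) + e"
    unfolding S_def n_def using Ni by (simp add: M.prob_space)
  have Spos: "S > 0" unfolding S using e by (intro add_nonneg_pos integral_nonneg) auto
  define h where "h x y = f x y powr r * n x powr (1 - r)" for x y
  have h0: "0 \<le> h x y" for x y unfolding h_def by simp
  have hm[measurable]: "case_prod h \<in> borel_measurable (M \<Otimes>\<^sub>M N)"
    unfolding h_def by measurable
  have hy: "(\<integral>y. h x y \<partial>N) \<le> n x" if "x \<in> space M" for x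
  proof -
    have "(\<integral>y. f x y powr r \<partial>N) = ((\<integral>y. f x y powr r \<partial>N) powr (1 / r)) powr r"
      using r by (simp add: powr_powr integral_nonneg)
    also have "\<dots> \<le> n x powr r"
      using r e unfolding n_def by (intro powr_mono2) auto
    finally have "(\<integral>y. h x y \<partial>N) \<le> n x powr r * n x powr (1 - r)"
      unfolding h_def using fi[OF that] by (simp add: mult_right_mono)
    also have "\<dots> = n x" using n0[of x] by (simp flip: powr_add)
    finally show ?thesis .
  qed
  \<comment> \<open>By Fubini, \<open>h _ y\<close> is integrable for almost every \<open>y\<close>, and then so is \<open>f _ y\<close>, since \<open>f \<le> h + n\<close>.\<close>
  have hi: "integrable (M \<Otimes>\<^sub>M N) (case_prod h)"
  proof (rule Fubini_integrable)
    show "integrable M (\<lambda>x. \<integral>y. norm (case_prod h (x, y)) \<partial>N)"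
      by (rule Bochner_Integration.integrable_bound[OF ni])
         (use hy h0 n0 in \<open>auto simp: less_imp_le integral_nonneg\<close>)
    show "AE x in M. integrable N (\<lambda>y. case_prod h (x, y))"
      using fi by (auto simp: h_def)
  qed auto
  have key: "(\<integral>x. f x y \<partial>M) powr r \<le> S powr (r - 1) * (\<integral>x. h x y \<partial>M)"
    if hiy: "integrable M (\<lambda>x. h x y)" and y: "y \<in> space N" for y
  proof -
    have fm[measurable]: "(\<lambda>x. f x y) \<in> borel_measurable M" using y by measurable
    have le: "f x y \<le> h x y + n x" for x
    proof (cases "f x y \<le> n x")
      case True then show ?thesis using h0[of x y] by simp
    next
      case False
      then have "f x y = f x y powr r * f x y powr (1 - r)" using n0[of x] by (simp flip: powr_add)
      also have "\<dots> \<le> h x y" unfolding h_def using False n0[of x] r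
        by (intro mult_left_mono powr_mono2') auto
      finally show ?thesis using n0[of x] by simp
    qed
    have fiy: "integrable M (\<lambda>x. f x y)"
      by (rule Bochner_Integration.integrable_bound[OF Bochner_Integration.integrable_add[OF hiy ni]])
         (use f0 h0 n0 le in \<open>auto simp: add_nonneg_nonneg less_imp_le\<close>)
    define m where "m = (\<integral>x. f x y \<partial>M)"
    have "m \<ge> 0" unfolding m_def using f0 by simp
    show ?thesis
    proof (cases "m = 0")
      case True then show ?thesis using h0 unfolding m_def by simp
    next
      case False
      with \<open>m \<ge> 0\<close> have m: "m > 0" by simp
      \<comment> \<open>The tangent at \<open>m\<close>, evaluated at \<open>S f / n\<close> and multiplied by the weight \<open>n / S\<close>.\<close>
      have pt: "r * m powr (r - 1) * f x y - (r - 1) * m powr r * (n x / S) \<le> S powr (r - 1) * h x y" for x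
      proof -
        have "r * (S * f x y / n x) * m powr (r - 1) \<le> (S * f x y / n x) powr r + (r - 1) * m powr r"
          using r Spos f0[of x y] n0[of x] m by (intro powr_above_tangent) auto
        then have "(r * (S * f x y / n x) * m powr (r - 1)) * (n x / S)
           \<le> ((S * f x y / n x) powr r + (r - 1) * m powr r) * (n x / S)"
          using n0[of x] Spos by (intro mult_right_mono) auto
        moreover have "(r * (S * f x y / n x) * m powr (r - 1)) * (n x / S) = r * m powr (r - 1) * f x y"
          using n0[of x] Spos by simp
        moreover have "(S * f x y / n x) powr r * (n x / S) = S powr (r - 1) * h x y"
          using n0[of x] Spos f0[of x y] unfolding h_def
          by (simp add: powr_divide powr_mult powr_diff field_simps)
        ultimately show ?thesis by (simp add: algebra_simps)
      qed
      have "m powr r = r * m powr (r - 1) * m - (r - 1) * m powr r * (S / S)"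
        using m Spos by (simp add: powr_diff field_simps)
      also have "\<dots> = (\<integral>x. r * m powr (r - 1) * f x y - (r - 1) * m powr r * (n x / S) \<partial>M)"
        using fiy ni by (simp add: m_def S_def)
      also have "\<dots> \<le> (\<integral>x. S powr (r - 1) * h x y \<partial>M)"
        using pt fiy ni hiy by (intro integral_mono) auto
      finally show ?thesis by (simp add: m_def)
    qed
  qed
  have "(\<integral>y. (\<integral>x. f x y \<partial>M) powr r \<partial>N) \<le> (\<integral>y. S powr (r - 1) * (\<integral>x. h x y \<partial>M) \<partial>N)"
  proof (rule integral_mono_AE')
    show "integrable N (\<lambda>y. S powr (r - 1) * (\<integral>x. h x y \<partial>M))"
      using integrable_snd[OF hi] by simp
    show "AE y in N. (\<integral>x. f x y \<partial>M) powr r \<le> S powr (r - 1) * (\<integral>x. h x y \<partial>M)"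
      using AE_integrable_snd[OF hi] AE_space by eventually_elim (rule key)
    show "AE y in N. 0 \<le> S powr (r - 1) * (\<integral>x. h x y \<partial>M)"
      using h0 by (intro AE_I2) simp
  qed
  also have "\<dots> = S powr (r - 1) * (\<integral>x. (\<integral>y. h x y \<partial>N) \<partial>M)"
    using Fubini_integral[OF hi] by simp
  also have "\<dots> \<le> S powr (r - 1) * S"
    unfolding S_def using hy integrable_fst[OF hi] ni by (intro mult_left_mono integral_mono) auto
  also have "\<dots> = S powr r" using Spos by (simp add: powr_diff)
  finally have "(\<integral>y. (\<integral>x. f x y \<partial>M) powr r \<partial>N) powr (1 / r) \<le> (S powr r) powr (1 / r)"
    using r by (intro powr_mono2) (auto simp: integral_nonneg)
  also have "\<dots> = S" using r Spos by (simp add: powr_powr)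
  finally show "(\<integral>y. (\<integral>x. f x y \<partial>M) powr r \<partial>N) powr (1 / r)
    \<le> (\<integral>x. (\<integral>y. f x y powr r \<partial>N) powr (1 / r) \<partial>M) + e" using S by simp
qed

section \<open>Hypercontractivity on the discrete cube\<close>

abbreviation fair_binomial :: "nat \<Rightarrow> nat measure" where
  "fair_binomial n \<equiv> measure_pmf (binomial_pmf n (1 / 2))"

lemma integrable_fair_binomial [simp]:
  fixes f :: "nat \<Rightarrow> 'b::{banach, second_countable_topology}"
  shows "integrable (fair_binomial n) f"
  by (rule integrable_measure_pmf_finite) (auto simp: set_pmf_binomial_eq)

lemma fair_binomial_cong:
  fixes f g :: "nat \<Rightarrow> 'b::{banach, second_countable_topology}"
  assumes "\<And>i. i \<le> n \<Longrightarrow> f i = g i"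
  shows "(\<integral>i. f i \<partial>fair_binomial n) = (\<integral>i. g i \<partial>fair_binomial n)"
  using assms by (intro integral_cong_AE) (auto simp: AE_measure_pmf_iff set_pmf_binomial_eq)

lemma fair_binomial_Suc:
  fixes \<phi> :: "nat \<Rightarrow> nat \<Rightarrow> 'b::{banach, second_countable_topology}"
  shows "(\<integral>i. \<phi> i (Suc n - i) \<partial>fair_binomial (Suc n))
    = (1 / 2) *\<^sub>R ((\<integral>i. \<phi> (Suc i) (n - i) \<partial>fair_binomial n) + (\<integral>i. \<phi> i (Suc (n - i)) \<partial>fair_binomial n))"
proof -
  have "(\<integral>i. \<phi> i (Suc n - i) \<partial>fair_binomial (Suc n))
     = (1 / 2) *\<^sub>R ((\<integral>i. \<phi> (Suc i) (Suc n - Suc i) \<partial>fair_binomial n)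
         + (\<integral>i. \<phi> i (Suc n - i) \<partial>fair_binomial n))"
    by (subst binomial_pmf_Suc)
       (simp_all add: pmf_expectation_bind[of UNIV] set_pmf_binomial_eq UNIV_bool
         flip: map_pmf_def scaleR_add_right)
  also have "(\<integral>i. \<phi> i (Suc n - i) \<partial>fair_binomial n) = (\<integral>i. \<phi> i (Suc (n - i)) \<partial>fair_binomial n)"
    by (rule fair_binomial_cong) (simp add: Suc_diff_le)
  finally show ?thesis by simp
qed

text \<open>
  The case of two summands, seen as an integral over a fair coin.
\<close>
lemma minkowski_two:
  fixes f g :: "nat \<Rightarrow> real"
  assumes p: "1 \<le> p" and pq: "p \<le> q" and f0: "\<And>i. 0 \<le> f i" and g0: "\<And>i. 0 \<le> g i"
  shows "(\<integral>i. ((f i powr p + g i powr p) / 2) powr (q / p) \<partial>fair_binomial n) powr (p / q)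
    \<le> ((\<integral>i. f i powr q \<partial>fair_binomial n) powr (p / q) + (\<integral>i. g i powr q \<partial>fair_binomial n) powr (p / q)) / 2"
proof -
  let ?M = "measure_pmf (bernoulli_pmf (1 / 2))"
  let ?F = "\<lambda>b i. (if b then f i else g i) powr p"
  have meas: "case_prod ?F \<in> borel_measurable (?M \<Otimes>\<^sub>M fair_binomial n)"
    by (subst measurable_cong_sets[OF sets_pair_measure_cong[OF
          sets_measure_pmf_count_space sets_measure_pmf_count_space] refl])
       (simp add: pair_measure_countable)
  have exp2: "(\<integral>b. h b \<partial>?M) = (h True + h False) / 2" for h :: "bool \<Rightarrow> real"
    by (simp add: add_divide_distrib)
  have [simp]: "p \<noteq> 0" using p by simp
  have "(\<integral>i. (\<integral>b. ?F b i \<partial>?M) powr (q / p) \<partial>fair_binomial n) powr (1 / (q / p))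
     \<le> (\<integral>b. (\<integral>i. ?F b i powr (q / p) \<partial>fair_binomial n) powr (1 / (q / p)) \<partial>?M)"
    by (rule minkowski_integral[OF _ _ _ meas])
       (use p pq in \<open>auto intro!: measure_pmf.prob_space_axioms integrable_measure_pmf_finite\<close>)
  then show ?thesis unfolding exp2 by (simp add: powr_powr)
qed

text \<open>
  The value of the \<open>l\<close>-th elementary symmetric polynomial at a point of the cube with \<open>i\<close> coordinates
  \<open>+1\<close> and \<open>j\<close> coordinates \<open>-1\<close> (a Krawtchouk polynomial in \<open>i\<close>), read off from its generating
  function. Since all functions on the cube considered here are symmetric, the cube itself can be
  replaced by the number of \<open>+1\<close> entries, which is binomially distributed.
\<close>
definition sign_esym :: "nat \<Rightarrow> nat \<Rightarrow> nat \<Rightarrow> complex" where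
  "sign_esym i j = coeff ([:1, 1:] ^ i * [:1, -1:] ^ j)"

lemma sign_esym_0 [simp]: "sign_esym i j 0 = 1"
  by (simp add: sign_esym_def coeff_mult_0 coeff_0_power)

lemma sign_esym_Suc_plus [simp]:
  "sign_esym (Suc i) j (Suc l) = sign_esym i j (Suc l) + sign_esym i j l"
proof -
  have "[:1, 1:] ^ Suc i * [:1, -1:] ^ j = [:1, 1:] * ([:1, 1:] ^ i * [:1, -1 :: complex:] ^ j)"
    by (simp only: power_Suc mult.assoc)
  then show ?thesis unfolding sign_esym_def by simp
qed

lemma sign_esym_Suc_minus [simp]:
  "sign_esym i (Suc j) (Suc l) = sign_esym i j (Suc l) - sign_esym i j l"
proof -
  have "[:1, 1:] ^ i * [:1, -1:] ^ Suc j = [:1, -1:] * ([:1, 1:] ^ i * [:1, -1 :: complex:] ^ j)"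
    by (simp only: power_Suc mult.left_commute)
  then show ?thesis unfolding sign_esym_def by simp
qed

lemma sign_esym_eq_0: "i + j < l \<Longrightarrow> sign_esym i j l = 0"
proof -
  assume "i + j < l"
  have "degree ([:1, 1:] ^ i * [:1, -1 :: complex:] ^ j) \<le> i + j"
    by (rule order.trans[OF degree_mult_le], rule add_mono)
       (rule order.trans[OF degree_power_le], simp)+
  with \<open>i + j < l\<close> show ?thesis unfolding sign_esym_def by (intro coeff_eq_0) simp
qed

text \<open>
  A symmetric function on the cube, given by its Fourier--Walsh coefficients; multiplying \<open>c l\<close>
  by \<open>z ^ l\<close> is the noise operator with complex parameter \<open>z\<close>. The sum stops at \<open>n\<close>, above
  which the elementary symmetric polynomials vanish, so that \<open>c\<close> ranges over all sequences and the class of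
  functions is closed under fixing a coordinate.
\<close>
definition chaos :: "nat \<Rightarrow> (nat \<Rightarrow> complex) \<Rightarrow> nat \<Rightarrow> nat \<Rightarrow> complex" where
  "chaos n c i j = (\<Sum>l\<le>n. c l * sign_esym i j l)"

text \<open>
  Fixing one coordinate to \<open>\<plusminus>1\<close> replaces the coefficients \<open>c l\<close> by \<open>c l \<plusminus> c (l + 1)\<close>. This closure property is
  what allows an induction on the dimension that stays within symmetric functions.
\<close>
lemma chaos_Suc: 
  assumes "i + j \<le> n" 
  shows "chaos (Suc n) c (Suc i) j = chaos n (\<lambda>l. c l + c (Suc l)) i j"
    and "chaos (Suc n) c i (Suc j) = chaos n (\<lambda>l. c l - c (Suc l)) i j"
proof -
  have "(\<Sum>l\<le>Suc n. c l * sign_esym i j l) = (\<Sum>l\<le>n. c l * sign_esym i j l)"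
    using assms by (simp add: sign_esym_eq_0)
  then have *: "c 0 + (\<Sum>l\<le>n. c (Suc l) * sign_esym i j (Suc l)) = (\<Sum>l\<le>n. c l * sign_esym i j l)"
    by (subst (asm) sum.atMost_Suc_shift) simp
  show "chaos (Suc n) c (Suc i) j = chaos n (\<lambda>l. c l + c (Suc l)) i j"
       "chaos (Suc n) c i (Suc j) = chaos n (\<lambda>l. c l - c (Suc l)) i j"
    unfolding chaos_def using *
    by (subst sum.atMost_Suc_shift; simp add: algebra_simps sum.distrib sum_subtractf)+
qed

lemma chaos_linear: 
  "chaos n (\<lambda>l. c l + w * d l) i j = chaos n c i j + w * chaos n d i j"
  by (simp add: chaos_def algebra_simps sum.distrib sum_distrib_left)

text \<open>
  Tensorization. Splitting off one coordinate writes the two values of the function after noise as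
  \<open>A \<plusminus> z B\<close>, where \<open>A\<close> and \<open>B\<close> depend on the other coordinates. The two-point inequality, applied pointwise,
  replaces \<open>z B\<close> by \<open>B\<close>; Minkowski's inequality moves the average over the split coordinate outside;
  and the two resulting functions \<open>A + B\<close> and \<open>A - B\<close> are noisy versions of the restrictions of the
  original function, to which the induction hypothesis applies.
\<close>
lemma discrete_hypercontractivity:
  fixes p q :: real and z :: complex
  assumes p: "1 \<le> p" and pq: "p \<le> q"
    and two_point: "\<And>c b :: complex.
      ((norm (c + z * b) powr q + norm (c - z * b) powr q) / 2) powr (1 / q)
        \<le> ((norm (c + b) powr p + norm (c - b) powr p) / 2) powr (1 / p)"
  shows "(\<integral>i. norm (chaos n (\<lambda>l. c l * z ^ l) i (n - i)) powr q \<partial>fair_binomial n) powr (p / q)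
    \<le> (\<integral>i. norm (chaos n c i (n - i)) powr p \<partial>fair_binomial n)"
proof (induction n arbitrary: c)
  case 0
  then show ?case using p pq by (simp add: binomial_pmf_0 chaos_def powr_powr)
next
  case (Suc n)
  define A where "A i = chaos n (\<lambda>l. c l * z ^ l) i (n - i)" for i
  define B where "B i = chaos n (\<lambda>l. c (Suc l) * z ^ l) i (n - i)" for i
  have two: "(norm (A i + z * B i) powr q + norm (A i - z * B i) powr q) / 2
     \<le> ((norm (A i + B i) powr p + norm (A i - B i) powr p) / 2) powr (q / p)" for i
  proof -
    have "(((norm (A i + z * B i) powr q + norm (A i - z * B i) powr q) / 2) powr (1 / q)) powr q
      \<le> (((norm (A i + B i) powr p + norm (A i - B i) powr p) / 2) powr (1 / p)) powr q"
      using p pq by (intro powr_mono2 two_point) auto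
    then show ?thesis using p pq by (simp add: powr_powr)
  qed
  have sup: "i \<le> n \<Longrightarrow> i + (n - i) \<le> n" for i by simp
  have zA: "chaos (Suc n) (\<lambda>l. c l * z ^ l) (Suc i) (n - i) = A i + z * B i"
           "chaos (Suc n) (\<lambda>l. c l * z ^ l) i (Suc (n - i)) = A i - z * B i"
    if "i \<le> n" for i
    using chaos_Suc[OF sup[OF that], of "\<lambda>l. c l * z ^ l"]
      chaos_linear[of n "\<lambda>l. c l * z ^ l" z "\<lambda>l. c (Suc l) * z ^ l" i "n - i"]
      chaos_linear[of n "\<lambda>l. c l * z ^ l" "- z" "\<lambda>l. c (Suc l) * z ^ l" i "n - i"]
    by (simp_all add: A_def B_def ac_simps)
  have AB: "A i + B i = chaos n (\<lambda>l. (c l + c (Suc l)) * z ^ l) i (n - i)"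
           "A i - B i = chaos n (\<lambda>l. (c l - c (Suc l)) * z ^ l) i (n - i)" for i
    using chaos_linear[of n "\<lambda>l. c l * z ^ l" 1 "\<lambda>l. c (Suc l) * z ^ l" i "n - i"]
      chaos_linear[of n "\<lambda>l. c l * z ^ l" "- 1" "\<lambda>l. c (Suc l) * z ^ l" i "n - i"]
    by (simp_all add: A_def B_def algebra_simps)
  have "(\<integral>i. norm (chaos (Suc n) (\<lambda>l. c l * z ^ l) i (Suc n - i)) powr q \<partial>fair_binomial (Suc n))
     = ((\<integral>i. norm (A i + z * B i) powr q \<partial>fair_binomial n) + (\<integral>i. norm (A i - z * B i) powr q \<partial>fair_binomial n)) / 2"
    unfolding fair_binomial_Suc[where \<phi> = "\<lambda>i j. norm (chaos (Suc n) (\<lambda>l. c l * z ^ l) i j) powr q"]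
    using zA by (simp cong: fair_binomial_cong)
  also have "\<dots> = (\<integral>i. (norm (A i + z * B i) powr q + norm (A i - z * B i) powr q) / 2 \<partial>fair_binomial n)"
    by simp
  also have "\<dots> \<le> (\<integral>i. ((norm (A i + B i) powr p + norm (A i - B i) powr p) / 2) powr (q / p) \<partial>fair_binomial n)"
    using two by (intro integral_mono) auto
  finally have "(\<integral>i. norm (chaos (Suc n) (\<lambda>l. c l * z ^ l) i (Suc n - i)) powr q \<partial>fair_binomial (Suc n)) powr (p / q)
    \<le> (\<integral>i. ((norm (A i + B i) powr p + norm (A i - B i) powr p) / 2) powr (q / p) \<partial>fair_binomial n) powr (p / q)"
    using p pq by (intro powr_mono2) (auto intro!: integral_nonneg)
  also have "\<dots> \<le> ((\<integral>i. norm (A i + B i) powr q \<partial>fair_binomial n) powr (p / q)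
       + (\<integral>i. norm (A i - B i) powr q \<partial>fair_binomial n) powr (p / q)) / 2"
    using p pq by (intro minkowski_two) auto
  also have "\<dots> \<le> ((\<integral>i. norm (chaos n (\<lambda>l. c l + c (Suc l)) i (n - i)) powr p \<partial>fair_binomial n)
       + (\<integral>i. norm (chaos n (\<lambda>l. c l - c (Suc l)) i (n - i)) powr p \<partial>fair_binomial n)) / 2"
    unfolding AB by (intro divide_right_mono add_mono Suc.IH) auto
  also have "\<dots> = (\<integral>i. norm (chaos (Suc n) c i (Suc n - i)) powr p \<partial>fair_binomial (Suc n))"
    unfolding fair_binomial_Suc[where \<phi> = "\<lambda>i j. norm (chaos (Suc n) c i j) powr p"]
    using chaos_Suc[OF sup, of _ c] by (simp cong: fair_binomial_cong)
  finally show ?case .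
qed

section \<open>Gaussian averages of polynomials\<close>

abbreviation gauss :: "real measure" where "gauss \<equiv> std_normal_distribution"

lemma prob_space_gauss: "prob_space gauss"
  using prob_space_normal_density[of 1 0] by simp

interpretation gauss: prob_space gauss by (rule prob_space_gauss)
interpretation gauss_pair: pair_prob_space gauss gauss ..

lemma measure_gauss_UNIV [simp]: "measure gauss UNIV = 1"
  using gauss.prob_space by simp

lemma has_bochner_integral_gauss_exp:
  "has_bochner_integral gauss (\<lambda>x. exp (c * x)) (exp (c\<^sup>2 / 2))"
proof -
  have eq: "std_normal_density x * exp (c * x) = exp (c\<^sup>2 / 2) * normal_density c 1 x" for x
    by (simp add: normal_density_def field_simps power2_eq_square flip: exp_add)
  have "has_bochner_integral lborel (\<lambda>x. exp (c\<^sup>2 / 2) * normal_density c 1 x) (exp (c\<^sup>2 / 2) * 1)"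
    by (intro has_bochner_integral_mult_right) (simp add: has_bochner_integral_iff)
  then have "has_bochner_integral lborel (\<lambda>x. std_normal_density x *\<^sub>R exp (c * x)) (exp (c\<^sup>2 / 2))"
    by (simp add: eq)
  then show ?thesis by (subst has_bochner_integral_density) auto
qed

lemma integrable_gauss_exp_abs: "integrable gauss (\<lambda>x. exp (c * \<bar>x\<bar>))"
proof (rule Bochner_Integration.integrable_bound)
  show "integrable gauss (\<lambda>x. exp (c * x) + exp ((- c) * x))"
    using has_bochner_integral_gauss_exp[of c] has_bochner_integral_gauss_exp[of "- c"]
    by (auto simp: has_bochner_integral_iff simp del: mult_minus_left)
  show "AE x in gauss. norm (exp (c * \<bar>x\<bar>)) \<le> norm (exp (c * x) + exp (- c * x))"
  proof (intro AE_I2)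
    fix x
    show "norm (exp (c * \<bar>x\<bar>)) \<le> norm (exp (c * x) + exp (- c * x))"
      by (subst real_norm_def, subst real_norm_def, subst (2) abs_of_pos)
         (auto simp: abs_if add_pos_pos)
  qed
qed auto

lemma integrable_gauss_power: "integrable gauss (\<lambda>x. complex_of_real x ^ k)"
  using integrable_std_normal_distribution_moment[of k]
  by (metis (mono_tags, lifting) Bochner_Integration.integrable_cong integrable_of_real of_real_power)

lemma integrable_gauss_pair_exp:
  "integrable (gauss \<Otimes>\<^sub>M gauss) (\<lambda>(x, y). exp (b * \<bar>x\<bar>) * exp (c * \<bar>y\<bar>))"
  by (rule gauss_pair.Fubini_integrable) (auto intro!: integrable_gauss_exp_abs)

text \<open>
  Every integrability question below reduces to this subexponential bound, because Gaussian measure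
  integrates \<open>exp (c * \<bar>x\<bar>)\<close> for all \<open>c\<close>.
\<close>
lemma poly_growth:
  fixes P :: "complex poly"
  assumes "\<epsilon> > 0"
  shows "\<exists>C>0. \<forall>w. norm (poly P w) \<le> C * exp (\<epsilon> * norm w)"
  using assms
proof (induction P arbitrary: \<epsilon>)
  case 0 then show ?case by (auto intro!: exI[of _ 1])
next
  case (pCons c P)
  obtain C where C: "C > 0" "\<And>w. norm (poly P w) \<le> C * exp (\<epsilon> / 2 * norm w)"
    using pCons.IH[of "\<epsilon> / 2"] pCons.prems by auto
  have "norm (poly (pCons c P) w) \<le> (norm c + C * (2 / \<epsilon>)) * exp (\<epsilon> * norm w)" for w
  proof -
    have 1: "norm w \<le> 2 / \<epsilon> * exp (\<epsilon> / 2 * norm w)"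
      using exp_ge_add_one_self[of "\<epsilon> / 2 * norm w"] pCons.prems by (simp add: field_simps)
    have "norm (poly (pCons c P) w) \<le> norm c + norm w * norm (poly P w)"
      by (simp add: norm_triangle_le norm_mult)
    also have "\<dots> \<le> norm c * exp (\<epsilon> * norm w)
        + (2 / \<epsilon> * exp (\<epsilon> / 2 * norm w)) * (C * exp (\<epsilon> / 2 * norm w))"
      using 1 C pCons.prems by (intro add_mono mult_mono mult_le_cancel_left1[THEN iffD2]) auto
    also have "\<dots> = (norm c + C * (2 / \<epsilon>)) * exp (\<epsilon> * norm w)"
      by (simp add: algebra_simps flip: exp_add)
    finally show ?thesis .
  qed
  moreover have "norm c + C * (2 / \<epsilon>) > 0" using C pCons.prems by (intro add_nonneg_pos) auto
  ultimately show ?case by blast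
qed

text \<open>
  The convolution with a centred Gaussian of complex standard deviation \<open>a\<close>. For imaginary \<open>a\<close> this
  is the backward heat flow, which exists on polynomials and maps \<open>w ^ l\<close> to a rescaled Hermite
  polynomial.
\<close>
definition gauss_mean :: "complex \<Rightarrow> (complex \<Rightarrow> complex) \<Rightarrow> complex \<Rightarrow> complex" where
  "gauss_mean a g w = (\<integral>v. g (w + a * of_real v) \<partial>gauss)"

lemma measurable_poly[measurable (raw)]:
  fixes P :: "complex poly"
  shows "f \<in> borel_measurable M \<Longrightarrow> (\<lambda>x. poly P (f x)) \<in> borel_measurable M"
  by (rule measurable_compose[where N = borel, OF _ borel_measurable_continuous_onI])
     (auto intro!: continuous_intros)

lemma integrable_gauss_pair_poly:
  fixes P :: "complex poly"
  shows "integrable (gauss \<Otimes>\<^sub>M gauss) (\<lambda>(x, y). poly P (w + a * of_real x + b * of_real y))"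
proof -
  obtain C where C: "C > 0" "\<And>w. norm (poly P w) \<le> C * exp (1 * norm w)"
    using poly_growth[of 1 P] by auto
  have "norm (poly P (w + a * of_real x + b * of_real y))
     \<le> C * exp (norm w) * (exp (norm a * \<bar>x\<bar>) * exp (norm b * \<bar>y\<bar>))" for x y :: real
  proof -
    have "norm (w + a * of_real x + b * of_real y) \<le> norm w + norm a * \<bar>x\<bar> + norm b * \<bar>y\<bar>"
      by (intro norm_triangle_mono) (auto simp: norm_mult)
    then have "C * exp (1 * norm (w + a * of_real x + b * of_real y))
      \<le> C * exp (norm w + norm a * \<bar>x\<bar> + norm b * \<bar>y\<bar>)" using C by simp
    then show ?thesis using C(2)[of "w + a * of_real x + b * of_real y"]
      by (simp add: exp_add mult.assoc)
  qed
  moreover have "integrable (gauss \<Otimes>\<^sub>M gauss)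
      (\<lambda>(x, y). C * exp (norm w) * (exp (norm a * \<bar>x\<bar>) * exp (norm b * \<bar>y\<bar>)))"
    using integrable_mult_right[OF integrable_gauss_pair_exp[of "norm a" "norm b"], of "C * exp (norm w)"]
    by (simp add: case_prod_beta' mult.assoc)
  ultimately show ?thesis using C
    by (elim Bochner_Integration.integrable_bound) (auto intro!: AE_I2)
qed

lemma integrable_gauss_poly:
  fixes P :: "complex poly"
  shows "integrable gauss (\<lambda>v. poly P (w + a * of_real v))"
proof -
  have "integrable (gauss \<Otimes>\<^sub>M gauss) (\<lambda>(x, y :: real). poly P (w + a * of_real x))"
    using integrable_gauss_pair_poly[of P w a 0] by simp
  from gauss_pair.integrable_fst[OF this] show ?thesis by simp
qed

text \<open>
  Induction on the polynomial needs the statement for integrands carrying an extra power of \<open>v\<close>,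
  because the factor \<open>w + a * v\<close> contributed by one degree raises that power.
\<close>
lemma gauss_mean_poly: "\<exists>R. gauss_mean a (poly P) = poly R"
proof -
  have "\<exists>R. \<forall>w. has_bochner_integral gauss
      (\<lambda>v. of_real v ^ k * poly P (w + a * of_real v)) (poly R w)" for k
  proof (induction P arbitrary: k)
    case 0 show ?case by (intro exI[of _ 0]) auto
  next
    case (pCons c P)
    obtain R where R: "\<And>w. has_bochner_integral gauss
      (\<lambda>v. of_real v ^ k * poly P (w + a * of_real v)) (poly R w)" using pCons.IH by blast
    obtain R' where R': "\<And>w. has_bochner_integral gauss
      (\<lambda>v. of_real v ^ Suc k * poly P (w + a * of_real v)) (poly R' w)" using pCons.IH by blast
    define m where "m = (\<integral>v. complex_of_real v ^ k \<partial>gauss)"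
    have m: "has_bochner_integral gauss (\<lambda>v. complex_of_real v ^ k) m"
      unfolding m_def using integrable_gauss_power by (rule has_bochner_integral_integrable)
    have "has_bochner_integral gauss (\<lambda>v. c * of_real v ^ k
        + w * (of_real v ^ k * poly P (w + a * of_real v))
        + a * (of_real v ^ Suc k * poly P (w + a * of_real v)))
       (c * m + w * poly R w + a * poly R' w)" for w
      by (intro has_bochner_integral_add has_bochner_integral_mult_right R R' m)
    then show ?case
      by (intro exI[of _ "[:c * m:] + pCons 0 R + smult a R'"]) (simp add: algebra_simps)
  qed
  from this[of 0] show ?thesis unfolding gauss_mean_def
    by (auto simp: has_bochner_integral_iff fun_eq_iff)
qed

lemma gauss_mean_commute:
  "gauss_mean a (gauss_mean b (poly P)) = gauss_mean b (gauss_mean a (poly P))"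
proof
  fix w
  show "gauss_mean a (gauss_mean b (poly P)) w = gauss_mean b (gauss_mean a (poly P)) w"
    using gauss_pair.Fubini_integral[OF integrable_gauss_pair_poly[of P w b a]]
    by (simp add: gauss_mean_def algebra_simps)
qed

text \<open>
  The Gaussian is the law of \<open>\<sigma> * x + \<tau> * y\<close> for independent standard Gaussians \<open>x\<close> and \<open>y\<close>.
  Comparing characteristic functions covers the degenerate cases \<open>\<sigma> = 0\<close> and \<open>\<tau> = 0\<close> as well, in which
  a density of one of the summands does not exist.
\<close>
lemma gauss_rotation:
  assumes "\<sigma>\<^sup>2 + \<tau>\<^sup>2 = 1"
  shows "distr (gauss \<Otimes>\<^sub>M gauss) borel (\<lambda>(x, y). \<sigma> * x + \<tau> * y) = gauss"
proof (rule Levy_uniqueness)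
  show "real_distribution (distr (gauss \<Otimes>\<^sub>M gauss) borel (\<lambda>(x, y). \<sigma> * x + \<tau> * y))"
    by (rule gauss_pair.real_distribution_distr) auto
  show "real_distribution gauss" by (rule real_dist_normal_dist)
  have int: "integrable gauss (\<lambda>x. iexp (t * x))" for t
    by (rule gauss.integrable_iexp) auto
  have ch: "(\<integral>x. iexp (t * x) \<partial>gauss) = complex_of_real (exp (- (t\<^sup>2) / 2))" for t
    using char_std_normal_distribution unfolding char_def fun_eq_iff by auto
  show "char (distr (gauss \<Otimes>\<^sub>M gauss) borel (\<lambda>(x, y). \<sigma> * x + \<tau> * y)) = char gauss"
  proof
    fix t
    have i2: "integrable (gauss \<Otimes>\<^sub>M gauss) (\<lambda>(x, y). iexp (t * \<sigma> * x) * iexp (t * \<tau> * y))"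
    proof (rule gauss_pair.Fubini_integrable)
      show "AE x in gauss. integrable gauss
          (\<lambda>y. case (x, y) of (x, y) \<Rightarrow> iexp (t * \<sigma> * x) * iexp (t * \<tau> * y))"
        unfolding prod.case using int by (intro AE_I2 integrable_mult_right) 
    qed (auto simp: norm_mult)
    have "char (distr (gauss \<Otimes>\<^sub>M gauss) borel (\<lambda>(x, y). \<sigma> * x + \<tau> * y)) t
      = (\<integral>(x, y). iexp (t * (\<sigma> * x + \<tau> * y)) \<partial>(gauss \<Otimes>\<^sub>M gauss))"
      unfolding char_def by (subst integral_distr) (auto simp: case_prod_beta')
    also have "\<dots> = (\<integral>(x, y). iexp (t * \<sigma> * x) * iexp (t * \<tau> * y) \<partial>(gauss \<Otimes>\<^sub>M gauss))"
      by (simp add: algebra_simps exp_add)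
    also have "\<dots> = (\<integral>x. (\<integral>y. iexp (t * \<sigma> * x) * iexp (t * \<tau> * y) \<partial>gauss) \<partial>gauss)"
      using gauss_pair.integral_fst[OF i2] by simp
    also have "\<dots> = complex_of_real (exp (- ((t * \<sigma>)\<^sup>2) / 2)) * complex_of_real (exp (- ((t * \<tau>)\<^sup>2) / 2))"
      using ch[of "t * \<sigma>"] ch[of "t * \<tau>"] by simp
    also have "\<dots> = complex_of_real (exp (- (t\<^sup>2) / 2))"
    proof -
      have "- ((t * \<sigma>)\<^sup>2) / 2 + - ((t * \<tau>)\<^sup>2) / 2 = - (t\<^sup>2) / 2 * (\<sigma>\<^sup>2 + \<tau>\<^sup>2)"
        by (simp add: power_mult_distrib algebra_simps)
      then show ?thesis using assms by (simp flip: of_real_mult exp_add)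
    qed
    finally show "char (distr (gauss \<Otimes>\<^sub>M gauss) borel (\<lambda>(x, y). \<sigma> * x + \<tau> * y)) t = char gauss t"
      by (simp add: char_std_normal_distribution)
  qed
qed

lemma gauss_rotation_integrable:
  fixes f :: "real \<Rightarrow> 'b::{banach, second_countable_topology}"
  assumes "\<sigma>\<^sup>2 + \<tau>\<^sup>2 = 1" "integrable gauss f"
  shows "integrable (gauss \<Otimes>\<^sub>M gauss) (\<lambda>(x, y). f (\<sigma> * x + \<tau> * y))"
proof -
  have "integrable (distr (gauss \<Otimes>\<^sub>M gauss) borel (\<lambda>(x, y). \<sigma> * x + \<tau> * y)) f"
    using assms by (simp add: gauss_rotation)
  from integrable_distr[OF _ this] show ?thesis by (simp add: case_prod_beta')
qed

lemma gauss_rotation_integral: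
  fixes f :: "real \<Rightarrow> 'b::{banach, second_countable_topology}"
  assumes st: "\<sigma>\<^sup>2 + \<tau>\<^sup>2 = 1" and f: "integrable gauss f"
  shows "(\<integral>x. (\<integral>y. f (\<sigma> * x + \<tau> * y) \<partial>gauss) \<partial>gauss) = (\<integral>x. f x \<partial>gauss)"
proof -
  have [measurable]: "f \<in> borel_measurable borel" using borel_measurable_integrable[OF f] by simp
  have "(\<integral>x. f x \<partial>gauss) = integral\<^sup>L (distr (gauss \<Otimes>\<^sub>M gauss) borel (\<lambda>(x, y). \<sigma> * x + \<tau> * y)) f"
    using gauss_rotation[OF st] by simp
  also have "\<dots> = (\<integral>(x, y). f (\<sigma> * x + \<tau> * y) \<partial>(gauss \<Otimes>\<^sub>M gauss))"
    by (subst integral_distr) (auto simp: case_prod_beta')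
  finally show ?thesis
    using gauss_pair.integral_fst[OF gauss_rotation_integrable[OF st f]] by simp
qed

text \<open>
  Semigroup law: \<open>gauss_mean a\<close> depends on variances only, and these add up.
\<close>
lemma gauss_mean_rotate:
  fixes \<sigma> \<tau> :: real
  assumes st: "\<sigma>\<^sup>2 + \<tau>\<^sup>2 = 1"
  shows "gauss_mean (a * of_real \<sigma>) (gauss_mean (a * of_real \<tau>) (poly P)) = gauss_mean a (poly P)"
proof
  fix w
  show "gauss_mean (a * of_real \<sigma>) (gauss_mean (a * of_real \<tau>) (poly P)) w = gauss_mean a (poly P) w"
    using gauss_rotation_integral[OF st integrable_gauss_poly[of P w a]]
    by (simp add: gauss_mean_def algebra_simps)
qed

section \<open>The de Moivre--Laplace theorem with exponential weights\<close>

text \<open>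
  Dominated convergence with a dominating function that varies with \<open>n\<close>, due to Pratt. Cutting \<open>f n\<close>
  off at the limit \<open>W\<close> leaves a sequence with a fixed bound, and the part cut off is at most
  \<open>max 0 (w n - W) = (w n - W) + max 0 (W - w n)\<close>, whose integral tends to \<open>0\<close>.
\<close>
lemma integral_tendsto_dominated_varying:
  fixes f w :: "nat \<Rightarrow> 'a \<Rightarrow> real"
  assumes w: "\<And>n. integrable M (w n)" "integrable M W"
    and fm[measurable]: "\<And>n. f n \<in> borel_measurable M" 
    and Fm[measurable]: "F \<in> borel_measurable M"
    and bd: "\<And>n x. x \<in> space M \<Longrightarrow> 0 \<le> f n x" "\<And>n x. x \<in> space M \<Longrightarrow> f n x \<le> w n x"
    and fl: "\<And>x. x \<in> space M \<Longrightarrow> (\<lambda>n. f n x) \<longlonglongrightarrow> F x"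
    and wl: "\<And>x. x \<in> space M \<Longrightarrow> (\<lambda>n. w n x) \<longlonglongrightarrow> W x"
    and wi: "(\<lambda>n. \<integral>x. w n x \<partial>M) \<longlonglongrightarrow> (\<integral>x. W x \<partial>M)"
  shows "(\<lambda>n. \<integral>x. f n x \<partial>M) \<longlonglongrightarrow> (\<integral>x. F x \<partial>M)"
proof -
  note [measurable] = borel_measurable_integrable[OF w(1)] borel_measurable_integrable[OF w(2)]
  have w0: "0 \<le> w n x" if "x \<in> space M" for n x using bd[OF that, of n] by linarith
  have W0: "0 \<le> W x" if "x \<in> space M" for x
    by (rule LIMSEQ_le_const[OF wl[OF that]]) (use w0[OF that] in auto)
  have FW: "F x \<le> W x" if "x \<in> space M" for x
    by (rule LIMSEQ_le[OF fl[OF that] wl[OF that]]) (use bd(2)[OF that] in auto)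
  have fi: "integrable M (f n)" for n
    by (rule Bochner_Integration.integrable_bound[OF w(1)[of n]])
       (use bd in \<open>auto intro!: AE_I2 intro: order.trans[OF _ abs_ge_self]\<close>)
  have m: "(\<lambda>n. \<integral>x. min (f n x) (W x) \<partial>M) \<longlonglongrightarrow> (\<integral>x. F x \<partial>M)"
  proof (rule integral_dominated_convergence[OF _ _ w(2)])
    show "AE x in M. (\<lambda>n. min (f n x) (W x)) \<longlonglongrightarrow> F x"
    proof (rule AE_I2)
      fix x assume x: "x \<in> space M"
      have "(\<lambda>n. min (f n x) (W x)) \<longlonglongrightarrow> min (F x) (W x)"
        by (intro tendsto_intros fl x)
      then show "(\<lambda>n. min (f n x) (W x)) \<longlonglongrightarrow> F x" using FW[OF x] by simp
    qed
    show "AE x in M. norm (min (f n x) (W x)) \<le> W x" for n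
      using bd(1)[of _ n] W0 by (intro AE_I2) (simp add: abs_of_nonneg)
  qed auto
  have d: "(\<lambda>n. \<integral>x. max 0 (W x - w n x) \<partial>M) \<longlonglongrightarrow> (\<integral>x. 0 \<partial>M)"
  proof (rule integral_dominated_convergence[OF _ _ w(2)])
    show "AE x in M. (\<lambda>n. max 0 (W x - w n x)) \<longlonglongrightarrow> 0"
    proof (rule AE_I2)
      fix x assume x: "x \<in> space M"
      have "(\<lambda>n. max 0 (W x - w n x)) \<longlonglongrightarrow> max 0 (W x - W x)"
        by (intro tendsto_intros wl x)
      then show "(\<lambda>n. max 0 (W x - w n x)) \<longlonglongrightarrow> 0" by simp
    qed
    show "AE x in M. norm (max 0 (W x - w n x)) \<le> W x" for n
      using w0 W0 by (intro AE_I2) (auto simp: abs_if max_def)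
  qed auto
  have di: "integrable M (\<lambda>x. max 0 (W x - w n x))" for n
    using w by (intro integrable_max) auto
  have mi: "integrable M (\<lambda>x. min (f n x) (W x))" for n
    using w fi by (intro integrable_min) auto
  let ?u = "\<lambda>n. (\<integral>x. w n x \<partial>M) - (\<integral>x. W x \<partial>M) + (\<integral>x. max 0 (W x - w n x) \<partial>M)"
  have "?u \<longlonglongrightarrow> (\<integral>x. W x \<partial>M) - (\<integral>x. W x \<partial>M) + (\<integral>x. 0 \<partial>M)"
    by (intro tendsto_intros wi d)
  then have u: "?u \<longlonglongrightarrow> 0" by simp
  have up: "(\<integral>x. f n x \<partial>M) \<le> (\<integral>x. min (f n x) (W x) \<partial>M) + ?u n" for n
  proof -
    have "(\<integral>x. f n x \<partial>M) \<le> (\<integral>x. min (f n x) (W x) + (w n x - W x + max 0 (W x - w n x)) \<partial>M)"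
    proof (intro integral_mono)
      fix x assume "x \<in> space M"
      from bd(2)[OF this, of n]
      show "f n x \<le> min (f n x) (W x) + (w n x - W x + max 0 (W x - w n x))" by linarith
    qed ((intro fi mi di w Bochner_Integration.integrable_add Bochner_Integration.integrable_diff)+)
    also have "\<dots> = (\<integral>x. min (f n x) (W x) \<partial>M) + ?u n"
      using w di mi by simp
    finally show ?thesis .
  qed
  have lo: "(\<integral>x. min (f n x) (W x) \<partial>M) \<le> (\<integral>x. f n x \<partial>M)" for n
    using mi fi by (intro integral_mono) auto
  have "(\<lambda>n. (\<integral>x. min (f n x) (W x) \<partial>M) + ?u n) \<longlonglongrightarrow> (\<integral>x. F x \<partial>M) + 0"
    by (intro tendsto_add m u)
  then have m': "(\<lambda>n. (\<integral>x. min (f n x) (W x) \<partial>M) + ?u n) \<longlonglongrightarrow> (\<integral>x. F x \<partial>M)"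
    by simp
  show ?thesis
    by (rule tendsto_sandwich[OF always_eventually[OF allI[OF lo]]
          always_eventually[OF allI[OF up]] m m'])
qed

text \<open>
  The normalized position after \<open>n\<close> steps, \<open>i\<close> of them to the right. For \<open>n = 0\<close> it is \<open>0\<close>.
\<close>
definition walk :: "nat \<Rightarrow> nat \<Rightarrow> real" where
  "walk n i = (real i - real (n - i)) / sqrt (real n)"

lemma fair_binomial_power:
  fixes a b :: "'b::{real_normed_field, banach, second_countable_topology}"
  shows "(\<integral>i. a ^ i * b ^ (n - i) \<partial>fair_binomial n) = ((a + b) / 2) ^ n"
proof (induction n)
  case (Suc n)
  have "(\<integral>i. a ^ i * b ^ (Suc n - i) \<partial>fair_binomial (Suc n)) =
    (1 / 2) *\<^sub>R ((\<integral>i. a * (a ^ i * b ^ (n - i)) \<partial>fair_binomial n) + (\<integral>i. b * (a ^ i * b ^ (n - i)) \<partial>fair_binomial n))"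
    using fair_binomial_Suc[where \<phi> = "\<lambda>i j. a ^ i * b ^ j" and n = n] by (simp add: ac_simps)
  also have "\<dots> = (a + b) / 2 * ((a + b) / 2) ^ n"
    unfolding integral_mult_right_zero Suc.IH by (simp add: scaleR_conv_of_real field_simps)
  finally show ?case by simp
qed (simp add: binomial_pmf_0)

text \<open>
  The characteristic function of the normalized walk is \<open>cos (t / sqrt n) ^ n\<close>.
\<close>
lemma walk_weak_conv: "weak_conv_m (\<lambda>n. distr (fair_binomial n) borel (walk n)) gauss"
proof (rule levy_continuity)
  show "real_distribution (distr (fair_binomial n) borel (walk n))" for n
    by (intro prob_space.real_distribution_distr measure_pmf.prob_space_axioms) auto
  show "real_distribution gauss" by (rule real_dist_normal_dist)
  fix t
  have "char (distr (fair_binomial n) borel (walk n)) t = of_real (cos (t / sqrt (real n)) ^ n)" for n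
  proof -
    let ?e = "exp (\<i> * of_real (t / sqrt (real n)))"
    let ?f = "exp (- (\<i> * of_real (t / sqrt (real n))))"
    have "char (distr (fair_binomial n) borel (walk n)) t = (\<integral>i. iexp (t * walk n i) \<partial>fair_binomial n)"
      unfolding char_def by (subst integral_distr) auto
    also have "\<dots> = (\<integral>i. ?e ^ i * ?f ^ (n - i) \<partial>fair_binomial n)"
      by (rule Bochner_Integration.integral_cong)
         (auto simp: walk_def diff_divide_distrib algebra_simps simp flip: exp_of_nat_mult exp_add)
    also have "\<dots> = ((?e + ?f) / 2) ^ n" by (rule fair_binomial_power)
    also have "(?e + ?f) / 2 = of_real (cos (t / sqrt (real n)))"
      by (simp add: cos_exp_eq cos_of_real[symmetric] del: cos_of_real)
    finally show ?thesis by simp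
  qed
  moreover have "(\<lambda>n. cos (t / sqrt (real n)) ^ n) \<longlonglongrightarrow> exp (- (t * t / 2))"
    by real_asymp
  ultimately show "(\<lambda>n. char (distr (fair_binomial n) borel (walk n)) t) \<longlonglongrightarrow> char gauss t"
    by (simp add: char_std_normal_distribution power2_eq_square tendsto_of_real del: of_real_power)
qed

text \<open>
  Weak convergence alone controls bounded functions only. The exponential moments of the walk can be
  computed explicitly, and their convergence rules out any escape of mass for functions bounded
  by a multiple of \<open>cosh\<close>.
\<close>
lemma fair_binomial_cosh_limit:
  "(\<lambda>n. \<integral>i. cosh (walk n i) \<partial>fair_binomial n) \<longlonglongrightarrow> (\<integral>x. cosh x \<partial>gauss)"
proof -
  have "(\<integral>i. exp (s * walk n i) \<partial>fair_binomial n) = cosh (s / sqrt (real n)) ^ n" for n and s :: real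
  proof -
    have "(\<integral>i. exp (s * walk n i) \<partial>fair_binomial n) 
      = (\<integral>i. exp (s / sqrt (real n)) ^ i * exp (- (s / sqrt (real n))) ^ (n - i) \<partial>fair_binomial n)"
      by (rule Bochner_Integration.integral_cong)
         (auto simp: walk_def diff_divide_distrib algebra_simps simp flip: exp_of_nat_mult exp_add)
    also have "\<dots> = ((exp (s / sqrt (real n)) + exp (- (s / sqrt (real n)))) / 2) ^ n"
      by (rule fair_binomial_power)
    finally show ?thesis by (simp add: cosh_def)
  qed
  note e = this[where s = 1] this[where s = "-1"]
  have "(\<integral>i. cosh (walk n i) \<partial>fair_binomial n) = cosh (1 / sqrt (real n)) ^ n" for n
    using e by (simp add: cosh_def[of "walk n _" for n])
  moreover have "(\<integral>x. cosh x \<partial>gauss) = exp (1 / 2)"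
    using has_bochner_integral_gauss_exp[of 1] has_bochner_integral_gauss_exp[of "-1"]
    by (simp add: cosh_def has_bochner_integral_iff)
  moreover have "(\<lambda>n. cosh (1 / sqrt (real n)) ^ n) \<longlonglongrightarrow> exp (1 / 2)"
    by real_asymp
  ultimately show ?thesis by simp
qed

lemma integrable_gauss_cosh: "integrable gauss cosh"
  using has_bochner_integral_gauss_exp[of 1] has_bochner_integral_gauss_exp[of "-1"]
  by (simp add: cosh_def[abs_def] has_bochner_integral_iff)

text \<open>
  By Skorohod's theorem the walks can be realized so as to converge pointwise. The hypothesis on
  \<open>f\<close> is then exactly pointwise convergence, and \<open>C * cosh\<close> evaluated along the walks is a varying dominating
  function with convergent integrals.
\<close>
lemma fair_binomial_limit:
  fixes f :: "nat \<Rightarrow> real \<Rightarrow> real" and F :: "real \<Rightarrow> real"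
  assumes fm[measurable]: "\<And>n. f n \<in> borel_measurable borel" and Fm[measurable]: "F \<in> borel_measurable borel"
    and bd: "\<And>n x. 0 \<le> f n x" "\<And>n x. f n x \<le> C * cosh x"
    and fl: "\<And>X x. X \<longlonglongrightarrow> x \<Longrightarrow> (\<lambda>n. f n (X n)) \<longlonglongrightarrow> F x"
  shows "(\<lambda>n. \<integral>i. f n (walk n i) \<partial>fair_binomial n) \<longlonglongrightarrow> (\<integral>x. F x \<partial>gauss)"
proof -
  have rd: "real_distribution (distr (fair_binomial n) borel (walk n))" for n
    by (intro prob_space.real_distribution_distr measure_pmf.prob_space_axioms) auto
  obtain \<Omega> :: "real measure" and Yn Y where "prob_space \<Omega> \<and> (\<forall>n. Yn n \<in> borel_measurable \<Omega>)
      \<and> (\<forall>n. distr \<Omega> borel (Yn n) = distr (fair_binomial n) borel (walk n))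
      \<and> Y \<in> measurable \<Omega> lborel \<and> distr \<Omega> borel Y = gauss
      \<and> (\<forall>x\<in>space \<Omega>. (\<lambda>n. Yn n x) \<longlonglongrightarrow> Y x)"
    using Skorohod[OF rd real_dist_normal_dist walk_weak_conv] by blast
  then have Y: "prob_space \<Omega>" "\<And>n. Yn n \<in> borel_measurable \<Omega>"
    "\<And>n. distr \<Omega> borel (Yn n) = distr (fair_binomial n) borel (walk n)" 
    "Y \<in> measurable \<Omega> lborel" "distr \<Omega> borel Y = gauss"
    "\<And>x. x \<in> space \<Omega> \<Longrightarrow> (\<lambda>n. Yn n x) \<longlonglongrightarrow> Y x"
    by blast+
  note [measurable] = Y(2)
  have [measurable]: "Y \<in> borel_measurable \<Omega>" using Y(4) by simp
  have tr: "(\<integral>x. h (Yn n x) \<partial>\<Omega>) = (\<integral>i. h (walk n i) \<partial>fair_binomial n)"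
    if [measurable]: "h \<in> borel_measurable borel" for h :: "real \<Rightarrow> real" and n
  proof -
    have "(\<integral>x. h (Yn n x) \<partial>\<Omega>) = integral\<^sup>L (distr \<Omega> borel (Yn n)) h"
      by (subst integral_distr) auto
    also have "\<dots> = (\<integral>i. h (walk n i) \<partial>fair_binomial n)"
      unfolding Y(3) by (subst integral_distr) auto
    finally show ?thesis .
  qed
  have trg: "(\<integral>x. h (Y x) \<partial>\<Omega>) = (\<integral>x. h x \<partial>gauss)"
    if [measurable]: "h \<in> borel_measurable borel" for h :: "real \<Rightarrow> real"
    unfolding Y(5)[symmetric] by (subst integral_distr) auto
  have cm[measurable]: "(cosh :: real \<Rightarrow> real) \<in> borel_measurable borel"
    by (intro borel_measurable_continuous_onI continuous_intros)
  have "(\<lambda>n. \<integral>x. f n (Yn n x) \<partial>\<Omega>) \<longlonglongrightarrow> (\<integral>x. F (Y x) \<partial>\<Omega>)"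
  proof (rule integral_tendsto_dominated_varying)
    show "integrable \<Omega> (\<lambda>x. C * cosh (Yn n x))" for n
    proof -
      have "integrable (distr \<Omega> borel (Yn n)) (\<lambda>x. C * cosh x)"
        unfolding Y(3) by (subst integrable_distr_eq) auto
      then show ?thesis by (subst (asm) integrable_distr_eq) auto
    qed
    show "integrable \<Omega> (\<lambda>x. C * cosh (Y x))"
    proof -
      have "integrable (distr \<Omega> borel Y) (\<lambda>x. C * cosh x)"
        unfolding Y(5) using integrable_gauss_cosh by auto
      then show ?thesis by (subst (asm) integrable_distr_eq) auto
    qed
    show "(\<lambda>n. \<integral>x. C * cosh (Yn n x) \<partial>\<Omega>) \<longlonglongrightarrow> (\<integral>x. C * cosh (Y x) \<partial>\<Omega>)"
      unfolding integral_mult_right_zero tr[OF cm] trg[OF cm]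
      by (intro tendsto_intros fair_binomial_cosh_limit)
    show "(\<lambda>n. C * cosh (Yn n x)) \<longlonglongrightarrow> C * cosh (Y x)" if "x \<in> space \<Omega>" for x
      using Y(6)[OF that] by (intro tendsto_intros)
    show "(\<lambda>n. f n (Yn n x)) \<longlonglongrightarrow> F (Y x)" if "x \<in> space \<Omega>" for x
      by (rule fl[OF Y(6)[OF that]])
  qed (simp_all add: bd)
  then show ?thesis unfolding tr[OF fm] trg[OF Fm] .
qed

section \<open>Symmetric Walsh polynomials and Hermite polynomials\<close>

text \<open>
  With \<open>\<beta> = 1 / n\<close> these are the suitably normalized Krawtchouk polynomials of the \<open>n\<close>-dimensional cube,
  and with \<open>\<beta> = 0\<close> the (probabilists') Hermite polynomials. Treating \<open>\<beta>\<close> as a continuous parameter makes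
  the passage from one to the other a matter of continuity.
\<close>
fun scaled_hermite :: "real \<Rightarrow> nat \<Rightarrow> real \<Rightarrow> real" where
  "scaled_hermite \<beta> 0 x = 1"
| "scaled_hermite \<beta> (Suc 0) x = x"
| "scaled_hermite \<beta> (Suc (Suc l)) x = x * scaled_hermite \<beta> (Suc l) x
     - real (l + 1) * (1 - real l * \<beta>) * scaled_hermite \<beta> l x"

lemma scaled_hermite_tendsto:
  assumes "(b \<longlongrightarrow> \<beta>) F" "(X \<longlongrightarrow> x) F"
  shows "((\<lambda>n. scaled_hermite (b n) l (X n)) \<longlongrightarrow> scaled_hermite \<beta> l x) F"
proof (induction l rule: induct_nat_012)
  case (ge2 l)
  then show ?case using assms by (auto intro!: tendsto_intros)
qed (use assms in auto)

lemma scaled_hermite_measurable [measurable]: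
  "(\<lambda>x. scaled_hermite \<beta> l x) \<in> borel_measurable borel"
  by (induction l rule: induct_nat_012) auto

text \<open>
  The bound has to be uniform in \<open>\<beta>\<close>, hence in the dimension of the cube, to serve as domination in the
  limit theorem.
\<close>
lemma scaled_hermite_growth:
  assumes "\<epsilon> > 0"
  shows "\<exists>C\<ge>0. \<forall>\<beta>\<in>{0..1}. \<forall>x. \<bar>scaled_hermite \<beta> l x\<bar> \<le> C * exp (\<epsilon> * \<bar>x\<bar>)"
  using assms
proof (induction l arbitrary: \<epsilon> rule: induct_nat_012)
  case 0
  then show ?case by (intro exI[of _ 1]) auto
next
  case 1
  have "\<bar>x\<bar> \<le> 1 / \<epsilon> * exp (\<epsilon> * \<bar>x\<bar>)" for x
  proof -
    have "\<epsilon> * \<bar>x\<bar> \<le> exp (\<epsilon> * \<bar>x\<bar>)"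
      using exp_ge_add_one_self[of "\<epsilon> * \<bar>x\<bar>"] by linarith
    then show ?thesis using 1 by (simp add: field_simps)
  qed
  then show ?case using 1 by (intro exI[of _ "1 / \<epsilon>"]) auto
next
  case (ge2 l)
  obtain C where C: "C \<ge> 0" "\<And>\<beta> x. \<beta> \<in> {0..1} \<Longrightarrow> \<bar>scaled_hermite \<beta> l x\<bar> \<le> C * exp (\<epsilon> * \<bar>x\<bar>)"
    using ge2.IH(1)[OF ge2.prems] by blast
  obtain D where D: "D \<ge> 0" "\<And>\<beta> x. \<beta> \<in> {0..1} \<Longrightarrow> \<bar>scaled_hermite \<beta> (Suc l) x\<bar> \<le> D * exp (\<epsilon> / 2 * \<bar>x\<bar>)"
    using ge2.IH(2)[of "\<epsilon> / 2"] ge2.prems by auto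
  have "\<bar>scaled_hermite \<beta> (Suc (Suc l)) x\<bar> \<le> (2 / \<epsilon> * D + real (l + 1) * real (l + 1) * C) * exp (\<epsilon> * \<bar>x\<bar>)"
    if b: "\<beta> \<in> {0..1}" for \<beta> x
  proof -
    have 1: "\<bar>x\<bar> \<le> 2 / \<epsilon> * exp (\<epsilon> / 2 * \<bar>x\<bar>)"
      using exp_ge_add_one_self[of "\<epsilon> / 2 * \<bar>x\<bar>"] ge2.prems by (simp add: field_simps)
    have "real l * \<beta> \<le> real l * 1" "0 \<le> real l * \<beta>" using b by (auto intro: mult_left_le)
    then have 2: "\<bar>1 - real l * \<beta>\<bar> \<le> real (l + 1)" by linarith
    have "\<bar>scaled_hermite \<beta> (Suc (Suc l)) x\<bar> \<le> \<bar>x\<bar> * \<bar>scaled_hermite \<beta> (Suc l) x\<bar>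
       + real (l + 1) * \<bar>1 - real l * \<beta>\<bar> * \<bar>scaled_hermite \<beta> l x\<bar>"
      unfolding scaled_hermite.simps
      by (rule order.trans[OF abs_triangle_ineq4]) (simp add: abs_mult)
    also have "\<dots> \<le> (2 / \<epsilon> * exp (\<epsilon> / 2 * \<bar>x\<bar>)) * (D * exp (\<epsilon> / 2 * \<bar>x\<bar>))
       + real (l + 1) * real (l + 1) * (C * exp (\<epsilon> * \<bar>x\<bar>))"
      using 1 2 C(2)[OF b, of x] D(2)[OF b, of x] ge2.prems by (intro add_mono mult_mono) auto
    also have "\<dots> = (2 / \<epsilon> * D + real (l + 1) * real (l + 1) * C) * exp (\<epsilon> * \<bar>x\<bar>)"
      by (simp add: algebra_simps flip: exp_add)
    finally show ?thesis .
  qed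
  moreover have "2 / \<epsilon> * D + real (l + 1) * real (l + 1) * C \<ge> 0" using C D ge2.prems by simp
  ultimately show ?case by blast
qed

text \<open>
  The generating function \<open>P = (1 + t)\<^sup>i (1 - t)\<^sup>j\<close> satisfies \<open>(1 - t\<^sup>2) P' = (i - j - (i + j) t) P\<close>;
  the recurrence compares the coefficients of \<open>t ^ (l + 1)\<close>.
\<close>
lemma sign_esym_recurrence:
  "of_nat (l + 2) * sign_esym i j (l + 2)
    = (of_nat i - of_nat j) * sign_esym i j (l + 1) - (of_nat i + of_nat j - of_nat l) * sign_esym i j l"
proof -
  define P where "P = [:1, 1:] ^ i * [:1, -1 :: complex:] ^ j"
  have d1: "[:1, 1:] * pderiv ([:1, 1 :: complex:] ^ i) = smult (of_nat i) ([:1, 1:] ^ i)"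
  proof (cases i)
    case (Suc k)
    have "pderiv [:1, 1 :: complex:] = [:1:]" by (simp add: pderiv_pCons)
    then show ?thesis unfolding Suc pderiv_power_Suc by (simp only: power_Suc) simp
  qed simp
  have d2: "[:1, -1:] * pderiv ([:1, -1 :: complex:] ^ j) = smult (- of_nat j) ([:1, -1:] ^ j)"
  proof (cases j)
    case (Suc k)
    have "pderiv [:1, -1 :: complex:] = [:-1:]" by (simp add: pderiv_pCons)
    then show ?thesis unfolding Suc pderiv_power_Suc by (simp only: power_Suc) simp
  qed simp
  have "[:1, 0, -1:] * pderiv P = 
     [:1, -1:] * [:1, -1:] ^ j * ([:1, 1:] * pderiv ([:1, 1 :: complex:] ^ i))
     + [:1, 1:] * [:1, 1:] ^ i * ([:1, -1:] * pderiv ([:1, -1 :: complex:] ^ j))"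
  proof -
    have *: "[:1, 0, -1 :: complex:] = [:1, 1:] * [:1, -1:]" by simp
    show ?thesis unfolding P_def pderiv_mult * by (simp only: algebra_simps)
  qed
  also have "\<dots> = [:of_nat i - of_nat j, - (of_nat i + of_nat j):] * P"
  proof -
    have *: "[:of_nat i - of_nat j, - (of_nat i + of_nat j) :: complex:]
      = smult (of_nat i) [:1, -1:] + smult (- of_nat j) [:1, 1:]" by simp
    show ?thesis unfolding d1 d2 P_def * 
      by (simp only: mult_smult_left mult_smult_right distrib_right distrib_left ac_simps)
  qed
  finally have "coeff ([:1, 0, -1:] * pderiv P) (l + 1)
     = coeff ([:of_nat i - of_nat j, - (of_nat i + of_nat j):] * P) (l + 1)" by simp
  then show ?thesis
    unfolding sign_esym_def P_def[symmetric]
    by (cases l) (simp_all add: coeff_pderiv algebra_simps)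
qed

lemma sign_esym_scaled_hermite:
  fixes n :: nat
  assumes "i + j = n" "n > 0"
  shows "fact l * sign_esym i j l / of_real (sqrt n) ^ l
    = of_real (scaled_hermite (1 / n) l ((real i - real j) / sqrt n))"
proof (induction l rule: induct_nat_012)
  case 0 show ?case by simp
next
  case 1
  have "sign_esym i j 1 = of_nat i - of_nat j"
  proof (induction i)
    case 0 show ?case
      by (induction j) (simp_all add: sign_esym_def coeff_0_power)
  qed simp
  then show ?case by simp
next
  case (ge2 l)
  define s where "s = complex_of_real (sqrt n)"
  have s: "s \<noteq> 0" "s * s = of_nat n"
    using assms by (simp_all add: s_def flip: of_real_mult)
  have "fact (Suc (Suc l)) * sign_esym i j (Suc (Suc l)) / s ^ Suc (Suc l)
      = fact (Suc l) / s ^ Suc (Suc l) * (of_nat (l + 2) * sign_esym i j (l + 2))"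
    by simp
  also have "\<dots> = fact (Suc l) / s ^ Suc (Suc l) * ((of_nat i - of_nat j) * sign_esym i j (Suc l)
      - (of_nat n - of_nat l) * sign_esym i j l)"
    unfolding sign_esym_recurrence using assms(1) by (simp flip: of_nat_add)
  also have "\<dots> = (of_nat i - of_nat j) / s * (fact (Suc l) * sign_esym i j (Suc l) / s ^ Suc l)
      - of_nat (l + 1) * ((of_nat n - of_nat l) / (s * s)) * (fact l * sign_esym i j l / s ^ l)"
    using s(1) by (simp add: field_simps)
  also have "(of_nat n - of_nat l) / (s * s) = of_real (1 - real l * (1 / n))"
    using assms(2) unfolding s(2) by (simp add: field_simps)
  also have "(of_nat i - of_nat j) / s = of_real ((real i - real j) / sqrt n)"
    by (simp add: s_def)
  finally show ?case unfolding ge2[folded s_def] s_def[symmetric] 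
    by (simp only: scaled_hermite.simps of_real_diff of_real_mult of_real_of_nat_eq)
qed

text \<open>
  Gaussian integration by parts for monomials. For \<open>k = 0\<close> the factor \<open>k\<close> makes the value of the
  truncated exponent \<open>k - 1\<close> irrelevant.
\<close>
lemma gauss_moment_Suc:
  "(\<integral>v. complex_of_real v ^ Suc k \<partial>gauss) = of_nat k * (\<integral>v. complex_of_real v ^ (k - 1) \<partial>gauss)"
proof -
  have "(\<integral>v. v ^ Suc k \<partial>gauss) = real k * (\<integral>v. v ^ (k - 1) \<partial>gauss)"
  proof (cases "even k")
    case True
    show ?thesis
    proof (cases "k = 0")
      case False
      with True have "odd (k - 1)" by auto
      then show ?thesis using True by (simp add: integral_std_normal_distribution_moment_odd del: power_Suc)
    qed (use integral_std_normal_distribution_moment_odd[of 1] in simp)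
  next
    case False
    then obtain m where m: "k = 2 * m + 1" by (auto elim: oddE)
    have "(\<integral>v. v ^ Suc k \<partial>gauss) = fact (2 * (m + 1)) / (2 ^ (m + 1) * fact (m + 1))"
      using std_normal_distribution_even_moments(1)[of "m + 1"] m by simp
    also have "\<dots> = real k * (fact (2 * m) / (2 ^ m * fact m))"
      by (simp add: m divide_simps)
    also have "(fact (2 * m) / (2 ^ m * fact m)) = (\<integral>v. v ^ (k - 1) \<partial>gauss)"
      using std_normal_distribution_even_moments(1)[of m] m by simp
    finally show ?thesis .
  qed
  then have "complex_of_real (\<integral>v. v ^ Suc k \<partial>gauss) = of_real (real k * (\<integral>v. v ^ (k - 1) \<partial>gauss))"
    by (rule arg_cong)
  then show ?thesis
    by (simp add: integral_complex_of_real[symmetric] del: power_Suc integral_complex_of_real)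
qed

text \<open>
  Extending integration by parts from \<open>v ^ k\<close> to \<open>v ^ k * (x + \<i> * v) ^ l\<close> (fact \<open>stein\<close>) yields, for \<open>k = 0\<close>,
  the three-term recurrence of the Hermite polynomials.
\<close>
lemma hermite_as_gauss_mean: 
  "(\<integral>v. (complex_of_real x + \<i> * of_real v) ^ l \<partial>gauss) = of_real (scaled_hermite 0 l x)"
proof -
  define J where "J k l = (\<integral>v. of_real v ^ k * (complex_of_real x + \<i> * of_real v) ^ l \<partial>gauss)" for k l
  have int: "integrable gauss (\<lambda>v. of_real v ^ k * (complex_of_real x + \<i> * of_real v) ^ l)" for k l
    using integrable_gauss_poly[of "monom 1 k * [:of_real x, \<i>:] ^ l" 0 1]
    by (simp add: poly_monom mult.commute)
  have J_Suc: "J k (Suc l) = of_real x * J k l + \<i> * J (Suc k) l" for k l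
  proof -
    have "J k (Suc l) = (\<integral>v. of_real x * (of_real v ^ k * (complex_of_real x + \<i> * of_real v) ^ l)
       + \<i> * (of_real v ^ Suc k * (complex_of_real x + \<i> * of_real v) ^ l) \<partial>gauss)"
      unfolding J_def by (simp add: algebra_simps)
    also have "\<dots> = of_real x * J k l + \<i> * J (Suc k) l"
      using int[of k l] int[of "Suc k" l] unfolding J_def by (subst Bochner_Integration.integral_add) auto
    finally show ?thesis .
  qed
  have stein: "J (Suc k) l = of_nat k * J (k - 1) l + \<i> * of_nat l * J k (l - 1)" for k l
  proof (induction l arbitrary: k)
    case 0
    show ?case using gauss_moment_Suc[of k] by (simp add: J_def)
  next
    case (Suc l)
    have "of_nat k * J (k - 1) (Suc l) = of_nat k * (of_real x * J (k - 1) l + \<i> * J k l)"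
      by (cases k) (simp_all add: J_Suc)
    moreover have "of_nat l * J k l = of_nat l * (of_real x * J k (l - 1) + \<i> * J (Suc k) (l - 1))"
      by (cases l) (simp_all add: J_Suc)
    ultimately show ?case
      unfolding J_Suc[of "Suc k" l] Suc.IH[of k] Suc.IH[of "Suc k"] by (simp add: algebra_simps)
  qed
  have "J 0 l = of_real (scaled_hermite 0 l x)"
  proof (induction l rule: induct_nat_012)
    case 1
    then show ?case using stein[of 0 0] by (simp add: J_Suc) (simp add: J_def)
  next
    case (ge2 l)
    have "J 0 (Suc (Suc l)) = of_real x * J 0 (Suc l) - of_nat (Suc l) * J 0 l"
      unfolding J_Suc[of 0 "Suc l"] stein[of 0 "Suc l"] by (simp add: algebra_simps)
    then show ?case using ge2 by simp
  qed (simp add: J_def)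
  then show ?thesis by (simp add: J_def)
qed

lemma gauss_mean_hermite:
  "gauss_mean (\<i> * z) (poly P) (z * of_real x)
    = (\<Sum>l\<le>degree P. coeff P l * z ^ l * of_real (scaled_hermite 0 l x))"
proof -
  have int: "integrable gauss (\<lambda>v. (complex_of_real x + \<i> * of_real v) ^ l)" for l
    using integrable_gauss_poly[of "[:of_real x, \<i>:] ^ l" 0 1] by (simp add: mult.commute)
  have "gauss_mean (\<i> * z) (poly P) (z * of_real x)
     = (\<integral>v. (\<Sum>l\<le>degree P. coeff P l * z ^ l * (complex_of_real x + \<i> * of_real v) ^ l) \<partial>gauss)"
    unfolding gauss_mean_def poly_altdef
    by (intro Bochner_Integration.integral_cong sum.cong refl)
       (simp add: mult.assoc algebra_simps flip: power_mult_distrib)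
  also have "\<dots> = (\<Sum>l\<le>degree P. coeff P l * z ^ l * of_real (scaled_hermite 0 l x))"
    using int by (subst Bochner_Integration.integral_sum) (simp_all add: hermite_as_gauss_mean)
  finally show ?thesis .
qed

section \<open>Complex hypercontractivity for Gaussian measure\<close>

lemma chaos_scaled_hermite:
  assumes "n > 0" "d \<le> n" "i \<le> n"
  shows "chaos n (\<lambda>l. if l \<le> d then c l * fact l / of_real (sqrt n) ^ l else 0) i (n - i)
    = (\<Sum>l\<le>d. c l * of_real (scaled_hermite (1 / n) l (walk n i)))"
proof -
  have "chaos n (\<lambda>l. if l \<le> d then c l * fact l / of_real (sqrt n) ^ l else 0) i (n - i)
    = (\<Sum>l\<le>d. (if l \<le> d then c l * fact l / of_real (sqrt n) ^ l else 0) * sign_esym i (n - i) l)"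
    unfolding chaos_def using assms by (intro sum.mono_neutral_right) auto
  also have "\<dots> = (\<Sum>l\<le>d. c l * (fact l * sign_esym i (n - i) l / of_real (sqrt n) ^ l))"
    by (intro sum.cong) auto
  also have "\<dots> = (\<Sum>l\<le>d. c l * of_real (scaled_hermite (1 / n) l (walk n i)))"
    using sign_esym_scaled_hermite[of i "n - i" n] assms by (simp add: walk_def)
  finally show ?thesis .
qed

lemma fair_binomial_hermite_limit:
  fixes c :: "nat \<Rightarrow> complex"
  assumes r: "r > 0"
  shows "(\<lambda>n. \<integral>i. norm (\<Sum>l\<le>d. c l * of_real (scaled_hermite (1 / n) l (walk n i))) powr r \<partial>fair_binomial n)
    \<longlonglongrightarrow> (\<integral>x. norm (\<Sum>l\<le>d. c l * of_real (scaled_hermite 0 l x)) powr r \<partial>gauss)"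
proof -
  have "\<exists>C. \<forall>l. C l \<ge> 0 \<and> (\<forall>\<beta>\<in>{0..1}. \<forall>x. \<bar>scaled_hermite \<beta> l x\<bar> \<le> C l * exp (1 / r * \<bar>x\<bar>))"
    using scaled_hermite_growth[of "1 / r"] r by (intro choice) auto
  then obtain C where C: "\<And>l. C l \<ge> 0"
    "\<And>l \<beta> x. \<beta> \<in> {0..1} \<Longrightarrow> \<bar>scaled_hermite \<beta> l x\<bar> \<le> C l * exp (1 / r * \<bar>x\<bar>)" by blast
  define K where "K = (\<Sum>l\<le>d. norm (c l) * C l)"
  have K: "K \<ge> 0" unfolding K_def using C by (intro sum_nonneg) auto
  show ?thesis
  proof (rule fair_binomial_limit[where C = "2 * K powr r"])
    fix n :: nat and x :: real
    have b: "1 / real n \<in> {0..1}" by (cases "n = 0") auto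
    have "norm (\<Sum>l\<le>d. c l * of_real (scaled_hermite (1 / n) l x)) \<le> (\<Sum>l\<le>d. norm (c l) * (C l * exp (1 / r * \<bar>x\<bar>)))"
      by (rule sum_norm_le) (auto simp: norm_mult intro!: mult_left_mono C(2)[OF b, simplified])
    also have "\<dots> = K * exp (1 / r * \<bar>x\<bar>)" by (simp add: K_def sum_distrib_right mult.assoc)
    finally have "norm (\<Sum>l\<le>d. c l * of_real (scaled_hermite (1 / n) l x)) powr r \<le> (K * exp (1 / r * \<bar>x\<bar>)) powr r"
      using r by (intro powr_mono2) auto
    also have "\<dots> = K powr r * exp \<bar>x\<bar>" using K r by (simp add: powr_mult exp_powr_real)
    also have "\<dots> \<le> K powr r * (2 * cosh x)"
      by (intro mult_left_mono) (auto simp: cosh_def abs_if)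
    finally show "norm (\<Sum>l\<le>d. c l * of_real (scaled_hermite (1 / n) l x)) powr r \<le> 2 * K powr r * cosh x"
      by simp
  next
    fix X :: "nat \<Rightarrow> real" and x assume X: "X \<longlonglongrightarrow> x"
    show "(\<lambda>n. norm (\<Sum>l\<le>d. c l * of_real (scaled_hermite (1 / n) l (X n))) powr r)
      \<longlonglongrightarrow> norm (\<Sum>l\<le>d. c l * of_real (scaled_hermite 0 l x)) powr r"
      using r by (intro tendsto_powr' tendsto_intros scaled_hermite_tendsto lim_1_over_n X) auto
  qed auto
qed

text \<open>
  The discrete inequality is applied to the function on the \<open>n\<close>-dimensional cube with coefficients
  \<open>fact l * coeff P l / sqrt n ^ l\<close>. In terms of the normalized walk it is a combination of scaled Hermite
  polynomials with \<open>\<beta> = 1 / n\<close> and coefficients that do not depend on \<open>n\<close>. As \<open>n\<close> grows, both sides converge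
  to the corresponding Gaussian integrals, in which \<open>gauss_mean (\<i> * z) (poly P) (z * x)\<close> is the image of
  \<open>gauss_mean \<i> (poly P) x\<close> under the operator that multiplies the \<open>l\<close>-th Hermite polynomial by \<open>z ^ l\<close>.
\<close>
lemma gaussian_hypercontractivity:
  fixes p q :: real and z :: complex
  assumes p: "1 \<le> p" and pq: "p \<le> q"
    and two_point: "\<And>c b :: complex.
      ((norm (c + z * b) powr q + norm (c - z * b) powr q) / 2) powr (1 / q)
        \<le> ((norm (c + b) powr p + norm (c - b) powr p) / 2) powr (1 / p)"
  shows "(\<integral>x. norm (gauss_mean (\<i> * z) (poly P) (z * of_real x)) powr q \<partial>gauss) powr (p / q)
    \<le> (\<integral>x. norm (gauss_mean \<i> (poly P) (of_real x)) powr p \<partial>gauss)"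
proof -
  define d where "d = degree P"
  let ?c = "coeff P"
  let ?E = "\<lambda>c r n. \<integral>i. norm (\<Sum>l\<le>d. c l * of_real (scaled_hermite (1 / n) l (walk n i))) powr r \<partial>fair_binomial n"
  \<comment> \<open>For \<open>n < d\<close> the function on the cube would lose its top coefficients.\<close>
  have ineq: "?E (\<lambda>l. ?c l * z ^ l) q n powr (p / q) \<le> ?E ?c p n" if n: "n \<ge> max 1 d" for n :: nat
  proof -
    let ?a = "\<lambda>l. if l \<le> d then ?c l * fact l / of_real (sqrt n) ^ l else 0"
    have e1: "chaos n ?a i (n - i) = (\<Sum>l\<le>d. ?c l * of_real (scaled_hermite (1 / n) l (walk n i)))"
      if "i \<le> n" for i
      using chaos_scaled_hermite[of n d i ?c] n that by auto
    have *: "(\<lambda>l. ?a l * z ^ l) = (\<lambda>l. if l \<le> d then (?c l * z ^ l) * fact l / of_real (sqrt n) ^ l else 0)"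
      by (auto simp: fun_eq_iff)
    have e2: "chaos n (\<lambda>l. ?a l * z ^ l) i (n - i)
        = (\<Sum>l\<le>d. ?c l * z ^ l * of_real (scaled_hermite (1 / n) l (walk n i)))"
      if "i \<le> n" for i
      unfolding * using chaos_scaled_hermite[of n d i "\<lambda>l. ?c l * z ^ l"] n that by auto
    have "?E (\<lambda>l. ?c l * z ^ l) q n
        = (\<integral>i. norm (chaos n (\<lambda>l. ?a l * z ^ l) i (n - i)) powr q \<partial>fair_binomial n)"
      using e2 by (intro fair_binomial_cong) simp
    moreover have "?E ?c p n = (\<integral>i. norm (chaos n ?a i (n - i)) powr p \<partial>fair_binomial n)"
      using e1 by (intro fair_binomial_cong) simp
    ultimately show ?thesis
      using discrete_hypercontractivity[OF p pq two_point, of n ?a] by simp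
  qed
  have "(\<lambda>n. ?E (\<lambda>l. ?c l * z ^ l) q n powr (p / q))
     \<longlonglongrightarrow> (\<integral>x. norm (\<Sum>l\<le>d. ?c l * z ^ l * of_real (scaled_hermite 0 l x)) powr q \<partial>gauss) powr (p / q)"
    using p pq by (intro tendsto_powr' fair_binomial_hermite_limit tendsto_intros) (auto intro!: always_eventually)
  moreover have "(\<lambda>n. ?E ?c p n) \<longlonglongrightarrow> (\<integral>x. norm (\<Sum>l\<le>d. ?c l * of_real (scaled_hermite 0 l x)) powr p \<partial>gauss)"
    using p by (intro fair_binomial_hermite_limit) auto
  ultimately have "(\<integral>x. norm (\<Sum>l\<le>d. ?c l * z ^ l * of_real (scaled_hermite 0 l x)) powr q \<partial>gauss) powr (p / q)
    \<le> (\<integral>x. norm (\<Sum>l\<le>d. ?c l * of_real (scaled_hermite 0 l x)) powr p \<partial>gauss)"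
    using ineq by (intro LIMSEQ_le) blast+
  then show ?thesis
    using gauss_mean_hermite[of z P] gauss_mean_hermite[of 1 P] by (simp add: d_def)
qed

text \<open>
  This form is used with \<open>w\<close> collecting the variables that are kept fixed.
\<close>
corollary gaussian_hypercontractivity_affine:
  fixes p q \<delta> :: real and z w :: complex
  assumes p: "1 \<le> p" and pq: "p \<le> q"
    and two_point: "\<And>c b :: complex.
      ((norm (c + z * b) powr q + norm (c - z * b) powr q) / 2) powr (1 / q)
        \<le> ((norm (c + b) powr p + norm (c - b) powr p) / 2) powr (1 / p)"
  shows "(\<integral>x. norm (gauss_mean (\<i> * z * \<delta>) (poly P) (w + z * \<delta> * of_real x)) powr q \<partial>gauss) powr (p / q)
    \<le> (\<integral>x. norm (gauss_mean (\<i> * \<delta>) (poly P) (w + of_real \<delta> * of_real x)) powr p \<partial>gauss)"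
proof -
  have "gauss_mean a (poly (pcompose P [:w, of_real \<delta>:])) b = gauss_mean (a * of_real \<delta>) (poly P) (w + of_real \<delta> * b)" for a b :: complex
    by (simp add: gauss_mean_def poly_pcompose algebra_simps)
  then show ?thesis
    using gaussian_hypercontractivity[OF p pq two_point, of "pcompose P [:w, of_real \<delta>:]"]
    by (simp add: mult.commute mult.left_commute)
qed

section \<open>Mixed norms\<close>

lemma norm_poly_powr_growth:
  fixes R :: "complex poly"
  assumes "r \<ge> 0"
  shows "\<exists>C\<ge>0. \<forall>w. norm (poly R w) powr r \<le> C * exp (r * norm w)"
proof -
  obtain C where C: "C > 0" "\<And>w. norm (poly R w) \<le> C * exp (1 * norm w)"
    using poly_growth[of 1 R] by auto
  have "norm (poly R w) powr r \<le> C powr r * exp (r * norm w)" for w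
  proof -
    have "norm (poly R w) powr r \<le> (C * exp (1 * norm w)) powr r"
      using C assms by (intro powr_mono2) auto
    also have "\<dots> = C powr r * exp (r * norm w)"
      using C by (simp add: powr_mult exp_powr_real mult.commute)
    finally show ?thesis .
  qed
  then show ?thesis by (intro exI[of _ "C powr r"]) auto
qed

lemma integrable_gauss_norm_poly:
  fixes R :: "complex poly"
  assumes r: "r \<ge> 0"
  shows "integrable gauss (\<lambda>x. norm (poly R (w + a * of_real x)) powr r)"
proof -
  obtain C where C: "C \<ge> 0" "\<And>w. norm (poly R w) powr r \<le> C * exp (r * norm w)"
    using norm_poly_powr_growth[OF r] by blast
  show ?thesis
  proof (rule Bochner_Integration.integrable_bound)
    show "integrable gauss (\<lambda>x. C * exp (r * norm w) * exp (r * norm a * \<bar>x\<bar>))"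
      by (intro integrable_mult_right integrable_gauss_exp_abs)
    show "AE x in gauss. norm (norm (poly R (w + a * of_real x)) powr r)
        \<le> norm (C * exp (r * norm w) * exp (r * norm a * \<bar>x\<bar>))"
    proof (rule AE_I2)
      fix x
      have "norm (w + a * of_real x) \<le> norm w + norm a * \<bar>x\<bar>"
        by (rule norm_triangle_le) (simp add: norm_mult)
      then have "r * norm (w + a * of_real x) \<le> r * norm w + r * norm a * \<bar>x\<bar>"
        using r mult_left_mono by (fastforce simp: algebra_simps)
      then have "C * exp (r * norm (w + a * of_real x)) \<le> C * exp (r * norm w + r * norm a * \<bar>x\<bar>)"
        using C by (intro mult_left_mono) auto
      then show "norm (norm (poly R (w + a * of_real x)) powr r)
        \<le> norm (C * exp (r * norm w) * exp (r * norm a * \<bar>x\<bar>))"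
        using C(2)[of "w + a * of_real x"] C(1) by (simp add: exp_add mult.assoc abs_mult)
    qed
  qed measurable
qed

lemma integrable_gauss_mixed_norm_poly:
  fixes R :: "complex poly"
  assumes r: "r \<ge> 0" and k: "k \<ge> 0"
  shows "integrable gauss (\<lambda>u. (\<integral>x. norm (poly R (w + a * of_real u + b * of_real x)) powr r \<partial>gauss) powr k)"
proof -
  obtain C where C: "C \<ge> 0" "\<And>w. norm (poly R w) powr r \<le> C * exp (r * norm w)"
    using norm_poly_powr_growth[OF r] by blast
  define D where "D = (\<integral>x. C * exp (r * norm w) * exp (r * norm b * \<bar>x\<bar>) \<partial>gauss)"
  have D: "D \<ge> 0" unfolding D_def using C(1) by (intro Bochner_Integration.integral_nonneg) simp
  show ?thesis
  proof (rule Bochner_Integration.integrable_bound)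
    show "integrable gauss (\<lambda>u. D powr k * exp (r * norm a * k * \<bar>u\<bar>))"
      by (intro integrable_mult_right integrable_gauss_exp_abs)
    show "AE u in gauss. norm ((\<integral>x. norm (poly R (w + a * of_real u + b * of_real x)) powr r \<partial>gauss) powr k)
        \<le> norm (D powr k * exp (r * norm a * k * \<bar>u\<bar>))"
    proof (rule AE_I2)
      fix u
      have "norm (poly R (w + a * of_real u + b * of_real x)) powr r
         \<le> exp (r * norm a * \<bar>u\<bar>) * (C * exp (r * norm w) * exp (r * norm b * \<bar>x\<bar>))" for x
      proof -
        have "norm (w + a * of_real u + b * of_real x) \<le> norm w + norm a * \<bar>u\<bar> + norm b * \<bar>x\<bar>"
          by (intro norm_triangle_mono) (auto simp: norm_mult)
        then have "r * norm (w + a * of_real u + b * of_real x) \<le> r * norm w + r * norm a * \<bar>u\<bar> + r * norm b * \<bar>x\<bar>"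
          using r mult_left_mono by (fastforce simp: algebra_simps)
        then have "C * exp (r * norm (w + a * of_real u + b * of_real x))
            \<le> C * exp (r * norm w + r * norm a * \<bar>u\<bar> + r * norm b * \<bar>x\<bar>)"
          using C by (intro mult_left_mono) auto
        then show ?thesis
          using C(2)[of "w + a * of_real u + b * of_real x"] by (simp add: exp_add ac_simps)
      qed
      then have "(\<integral>x. norm (poly R (w + a * of_real u + b * of_real x)) powr r \<partial>gauss)
        \<le> (\<integral>x. exp (r * norm a * \<bar>u\<bar>) * (C * exp (r * norm w) * exp (r * norm b * \<bar>x\<bar>)) \<partial>gauss)"
        using r by (intro integral_mono integrable_gauss_norm_poly integrable_mult_right integrable_gauss_exp_abs)
      also have "\<dots> = exp (r * norm a * \<bar>u\<bar>) * D" by (simp add: D_def)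
      finally have "(\<integral>x. norm (poly R (w + a * of_real u + b * of_real x)) powr r \<partial>gauss) powr k
        \<le> (exp (r * norm a * \<bar>u\<bar>) * D) powr k"
        using k by (intro powr_mono2) auto
      also have "\<dots> = D powr k * exp (r * norm a * k * \<bar>u\<bar>)"
        using D by (simp add: powr_mult exp_powr_real ac_simps)
      finally show "norm ((\<integral>x. norm (poly R (w + a * of_real u + b * of_real x)) powr r \<partial>gauss) powr k)
        \<le> norm (D powr k * exp (r * norm a * k * \<bar>u\<bar>))" by simp
    qed
  qed measurable
qed

text \<open>
  Here \<open>x\<close> is the Gaussian variable that changes sides: on the left it carries the factor \<open>z\<close> and is
  averaged together with \<open>y\<close> in \<open>L\<^sup>q\<close>, on the right the factor is gone and it is averaged in \<open>L\<^sup>p\<close>, outside.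
  For fixed \<open>y\<close>, hypercontractivity in \<open>x\<close> removes \<open>z\<close>; Minkowski's inequality with exponent \<open>q / p\<close> then
  exchanges the two norms.
\<close>
lemma mixed_norm_step:
  fixes p q \<beta> \<delta> :: real and z w :: complex
  assumes p: "1 \<le> p" and pq: "p \<le> q"
    and two_point: "\<And>c b :: complex.
      ((norm (c + z * b) powr q + norm (c - z * b) powr q) / 2) powr (1 / q)
        \<le> ((norm (c + b) powr p + norm (c - b) powr p) / 2) powr (1 / p)"
    and S: "gauss_mean (\<i> * z * \<delta>) (poly K) = poly S" and T: "gauss_mean (\<i> * \<delta>) (poly K) = poly T"
  shows "(\<integral>y. (\<integral>x. norm (poly S (w + z * \<beta> * of_real y + z * \<delta> * of_real x)) powr q \<partial>gauss) \<partial>gauss) powr (p / q)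
    \<le> (\<integral>x. (\<integral>y. norm (poly T (w + of_real \<delta> * of_real x + z * \<beta> * of_real y)) powr q \<partial>gauss) powr (p / q) \<partial>gauss)"
proof -
  define f where "f x y = norm (poly T (w + of_real \<delta> * of_real x + z * \<beta> * of_real y)) powr p" for x y :: real
  have q0: "q > 0" using p pq by simp
  have fr: "f x y powr (q / p) = norm (poly T (w + of_real \<delta> * of_real x + z * \<beta> * of_real y)) powr q" for x y
    unfolding f_def using p by (simp add: powr_powr)
  have hyp: "(\<integral>x. norm (poly S (w + z * \<beta> * of_real y + z * \<delta> * of_real x)) powr q \<partial>gauss)
     \<le> (\<integral>x. f x y \<partial>gauss) powr (q / p)" for y :: real
  proof -
    have "((\<integral>x. norm (poly S (w + z * \<beta> * of_real y + z * \<delta> * of_real x)) powr q \<partial>gauss) powr (p / q)) powr (q / p)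
      \<le> (\<integral>x. norm (poly T (w + z * \<beta> * of_real y + of_real \<delta> * of_real x)) powr p \<partial>gauss) powr (q / p)"
      using gaussian_hypercontractivity_affine[OF p pq two_point, of \<delta> K "w + z * \<beta> * of_real y"] p pq
      unfolding S T by (intro powr_mono2) auto
    then show ?thesis using p q0 by (simp add: powr_powr f_def ac_simps)
  qed
  have "(\<integral>y. (\<integral>x. norm (poly S (w + z * \<beta> * of_real y + z * \<delta> * of_real x)) powr q \<partial>gauss) \<partial>gauss)
    \<le> (\<integral>y. (\<integral>x. f x y \<partial>gauss) powr (q / p) \<partial>gauss)"
  proof (rule integral_mono')
    show "integrable gauss (\<lambda>y. (\<integral>x. f x y \<partial>gauss) powr (q / p))"
      using integrable_gauss_mixed_norm_poly[of p "q / p" T w "z * \<beta>" "of_real \<delta>"] p pq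
      by (simp add: f_def ac_simps)
  qed (use hyp in auto)
  then have "(\<integral>y. (\<integral>x. norm (poly S (w + z * \<beta> * of_real y + z * \<delta> * of_real x)) powr q \<partial>gauss) \<partial>gauss) powr (p / q)
    \<le> (\<integral>y. (\<integral>x. f x y \<partial>gauss) powr (q / p) \<partial>gauss) powr (1 / (q / p))"
    using p q0 by (simp, intro powr_mono2) (auto intro!: integral_nonneg)
  also have "\<dots> \<le> (\<integral>x. (\<integral>y. f x y powr (q / p) \<partial>gauss) powr (1 / (q / p)) \<partial>gauss)"
  proof (rule minkowski_integral)
    show "case_prod f \<in> borel_measurable (gauss \<Otimes>\<^sub>M gauss)" unfolding f_def by measurable
    show "integrable gauss (\<lambda>y. f x y powr (q / p))" for x
      unfolding fr using q0 integrable_gauss_norm_poly[of q T "w + of_real \<delta> * of_real x"] by simp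
    show "integrable gauss (\<lambda>x. (\<integral>y. f x y powr (q / p) \<partial>gauss) powr (1 / (q / p)))"
      unfolding fr using q0 p by (intro integrable_gauss_mixed_norm_poly) auto
  qed (use p pq in \<open>auto simp: f_def prob_space_gauss\<close>)
  finally show ?thesis unfolding fr by simp
qed

text \<open>
  By rotation invariance the inner variable with weight \<open>\<eta>\<close> splits into independent parts with weights
  \<open>\<beta>\<close> and \<open>\<delta>\<close>, and the outer variable with weight \<open>\<theta>\<close> into parts with weights \<open>\<alpha>\<close> and \<open>\<delta>\<close>. The two sides then
  differ only in the role of the part with weight \<open>\<delta>\<close>, and \<open>mixed_norm_step\<close> applies for every value of
  the part with weight \<open>\<alpha>\<close>. The same splitting, applied to the averages over the imaginary parts, shows that
  both integrands come from one polynomial \<open>K\<close>.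
\<close>
lemma mixed_norm_mono:
  fixes p q \<alpha> \<beta> \<delta> \<eta> \<theta> :: real and z :: complex and P :: "complex poly"
  assumes p: "1 \<le> p" and pq: "p \<le> q"
    and two_point: "\<And>c b :: complex.
      ((norm (c + z * b) powr q + norm (c - z * b) powr q) / 2) powr (1 / q)
        \<le> ((norm (c + b) powr p + norm (c - b) powr p) / 2) powr (1 / p)"
    and \<eta>: "\<eta>\<^sup>2 = \<beta>\<^sup>2 + \<delta>\<^sup>2" "\<eta> \<noteq> 0" and \<theta>: "\<theta>\<^sup>2 = \<alpha>\<^sup>2 + \<delta>\<^sup>2" "\<theta> \<noteq> 0"
  shows "(\<integral>u. (\<integral>x. norm (gauss_mean (\<i> * z * \<eta>) (gauss_mean (\<i> * \<alpha>) (poly P))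
            (of_real \<alpha> * of_real u + z * \<eta> * of_real x)) powr q \<partial>gauss) powr (p / q) \<partial>gauss)
    \<le> (\<integral>u. (\<integral>x. norm (gauss_mean (\<i> * z * \<beta>) (gauss_mean (\<i> * \<theta>) (poly P))
            (of_real \<theta> * of_real u + z * \<beta> * of_real x)) powr q \<partial>gauss) powr (p / q) \<partial>gauss)"
proof -
  have q0: "q > 0" using p pq by simp
  have rot_\<eta>: "(\<beta> / \<eta>)\<^sup>2 + (\<delta> / \<eta>)\<^sup>2 = 1" using \<eta>(2) by (simp add: power_divide flip: add_divide_distrib \<eta>(1))
  have rot_\<theta>: "(\<alpha> / \<theta>)\<^sup>2 + (\<delta> / \<theta>)\<^sup>2 = 1" using \<theta>(2) by (simp add: power_divide flip: add_divide_distrib \<theta>(1))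
  \<comment> \<open>\<open>K\<close> has already undergone the averages that the two sides share.\<close>
  obtain A where A: "gauss_mean (\<i> * \<alpha>) (poly P) = poly A" using gauss_mean_poly by blast
  obtain K where K: "gauss_mean (\<i> * z * \<beta>) (poly A) = poly K" using gauss_mean_poly by blast
  obtain S where S: "gauss_mean (\<i> * z * \<delta>) (poly K) = poly S" using gauss_mean_poly by blast
  obtain T where T: "gauss_mean (\<i> * \<delta>) (poly K) = poly T" using gauss_mean_poly by blast
  have S': "gauss_mean (\<i> * z * \<eta>) (gauss_mean (\<i> * \<alpha>) (poly P)) = poly S"
    using gauss_mean_rotate[of "\<delta> / \<eta>" "\<beta> / \<eta>" "\<i> * z * \<eta>" A] rot_\<eta> \<eta>(2) K S
    by (simp add: A add.commute mult.assoc)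
  have T': "gauss_mean (\<i> * z * \<beta>) (gauss_mean (\<i> * \<theta>) (poly P)) = poly T"
    using gauss_mean_rotate[of "\<delta> / \<theta>" "\<alpha> / \<theta>" "\<i> * \<theta>" P] rot_\<theta> \<theta>(2) K T
      gauss_mean_commute[of "\<i> * z * \<beta>" "\<i> * \<delta>" A]
    by (simp add: A add.commute)
  define F where "F u = (\<integral>x. norm (poly T (of_real \<theta> * of_real u + z * \<beta> * of_real x)) powr q \<partial>gauss) powr (p / q)" for u :: real
  have Fi: "integrable gauss F"
    unfolding F_def[abs_def] using integrable_gauss_mixed_norm_poly[of q "p / q" T 0] p q0 by simp
  have Frot: "F (\<alpha> / \<theta> * u + \<delta> / \<theta> * x)
      = (\<integral>y. norm (poly T (of_real \<alpha> * of_real u + of_real \<delta> * of_real x + z * \<beta> * of_real y)) powr q \<partial>gauss) powr (p / q)" for u x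
  proof -
    have "complex_of_real \<theta> * of_real (\<alpha> / \<theta> * u + \<delta> / \<theta> * x) = of_real \<alpha> * of_real u + of_real \<delta> * of_real x"
      using \<theta>(2) by (simp add: field_simps)
    then show ?thesis unfolding F_def by simp
  qed
  have "(\<integral>u. (\<integral>x. norm (poly S (of_real \<alpha> * of_real u + z * \<eta> * of_real x)) powr q \<partial>gauss) powr (p / q) \<partial>gauss)
    \<le> (\<integral>u. (\<integral>x. F (\<alpha> / \<theta> * u + \<delta> / \<theta> * x) \<partial>gauss) \<partial>gauss)"
  proof (rule integral_mono')
    show "integrable gauss (\<lambda>u. \<integral>x. F (\<alpha> / \<theta> * u + \<delta> / \<theta> * x) \<partial>gauss)"
      using gauss_pair.integrable_fst[OF gauss_rotation_integrable[OF rot_\<theta> Fi]] .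
    fix u :: real
    have "(\<integral>x. norm (poly S (of_real \<alpha> * of_real u + z * \<eta> * of_real x)) powr q \<partial>gauss)
      = (\<integral>y. (\<integral>x. norm (poly S (of_real \<alpha> * of_real u + z * \<eta> * of_real (\<beta> / \<eta> * y + \<delta> / \<eta> * x))) powr q \<partial>gauss) \<partial>gauss)"
      using q0 by (intro gauss_rotation_integral[OF rot_\<eta>, symmetric] integrable_gauss_norm_poly) auto
    also have "\<dots> = (\<integral>y. (\<integral>x. norm (poly S (of_real \<alpha> * of_real u + z * \<beta> * of_real y + z * \<delta> * of_real x)) powr q \<partial>gauss) \<partial>gauss)"
    proof -
      have "z * \<eta> * of_real (\<beta> / \<eta> * y + \<delta> / \<eta> * x) = z * \<beta> * of_real y + z * \<delta> * of_real x" for x y :: real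
        using \<eta>(2) by (simp add: field_simps)
      then show ?thesis by (simp add: add.assoc)
    qed
    finally show "(\<integral>x. norm (poly S (of_real \<alpha> * of_real u + z * \<eta> * of_real x)) powr q \<partial>gauss) powr (p / q)
      \<le> (\<integral>x. F (\<alpha> / \<theta> * u + \<delta> / \<theta> * x) \<partial>gauss)"
      unfolding Frot using mixed_norm_step[OF p pq two_point S T, of "of_real \<alpha> * of_real u" \<beta>] by simp
    show "0 \<le> (\<integral>x. F (\<alpha> / \<theta> * u + \<delta> / \<theta> * x) \<partial>gauss)" unfolding F_def by simp
  qed
  also have "\<dots> = (\<integral>u. F u \<partial>gauss)" by (rule gauss_rotation_integral[OF rot_\<theta> Fi])
  finally show ?thesis unfolding S' T' F_def .
qed

theorem corollary1:
  fixes p q :: real and z :: complex and L :: nat and a :: "nat \<Rightarrow> complex"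
    and g :: "complex \<Rightarrow> complex"
  assumes "1 \<le> p" and "p \<le> q" and "norm z \<le> 1"
    and two_point: "\<And>c b :: complex.
      ((norm (c + z * b) powr q + norm (c - z * b) powr q) / 2) powr (1 / q)
        \<le> ((norm (c + b) powr p + norm (c - b) powr p) / 2) powr (1 / p)"
    and g: "\<And>w. g w = (\<Sum>l = 0..L. a l * w ^ l)"
  shows "mono_on {0..1} (\<lambda>s :: real.
    \<integral>u. (\<integral>x. norm (\<integral>y. (\<integral>v.
              g ((of_real u + \<i> * of_real v) * of_real (sqrt s)
                 + z * (of_real x + \<i> * of_real y) * of_real (sqrt (1 - s)))
            \<partial>std_normal_distribution) \<partial>std_normal_distribution) powr q
          \<partial>std_normal_distribution) powr (p / q)
    \<partial>std_normal_distribution)"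
proof -
  define P where "P = (\<Sum>l = 0..L. monom (a l) l)"
  have gP: "g = poly P" by (simp add: fun_eq_iff P_def g poly_sum poly_monom)
  have eq: "(\<integral>y. (\<integral>v. g ((of_real u + \<i> * of_real v) * of_real (sqrt s)
                 + z * (of_real x + \<i> * of_real y) * of_real (sqrt (1 - s))) \<partial>gauss) \<partial>gauss)
     = gauss_mean (\<i> * z * sqrt (1 - s)) (gauss_mean (\<i> * sqrt s) (poly P))
          (of_real (sqrt s) * of_real u + z * sqrt (1 - s) * of_real x)" for s u x :: real
    by (simp add: gauss_mean_def gP algebra_simps)
  show ?thesis unfolding eq
  proof (rule mono_onI)
    fix s t :: real assume st: "s \<in> {0..1}" "t \<in> {0..1}" "s \<le> t"
    let ?G = "\<lambda>s. \<integral>u. (\<integral>x. norm (gauss_mean (\<i> * z * sqrt (1 - s)) (gauss_mean (\<i> * sqrt s) (poly P))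
          (of_real (sqrt s) * of_real u + z * sqrt (1 - s) * of_real x)) powr q \<partial>gauss) powr (p / q) \<partial>gauss"
    show "?G s \<le> ?G t"
    proof (cases "s = t")
      case False
      then show ?thesis using st
        \<comment> \<open>The increment \<open>t - s\<close> is the variance that moves from the inner to the outer variable.\<close>
        by (intro mixed_norm_mono[OF assms(1,2) two_point, where \<delta> = "sqrt (t - s)"]) auto
    qed simp
  qed
qed

end
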